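(* Suppose that $\mathbb{E}(\|Z\|^2) < \infty$ and $\mu := \mathbb{E} Z \neq \mathbf{0}$, and let $\hat\mu := \mu/\|\mu\|$. Then, as $n\to\infty$, \[ n^{-1/2}\left| L_n - 2 S_n\cdot\hat\mu \right| \to 0, \quad \text{in } L^2. \]
   Context: Let $Z, Z_1, Z_2, \ldots$ be i.i.d. random variables in $\mathbb{R}^2$, and let $S_0 := \mathbf{0}$ (the origin) and $S_n := \sum_{k=1}^n Z_k$ for $n \ge 1$. Let $L_n$ be the perimeter length of the convex hull of $\{S_0, \ldots, S_n\}$. (If the hull is a line segment, its perimeter length is twice the length of the segment; in general, $L_n = \int_0^{2\pi} \max_{0\le k\le n} (S_k\cdot \mathbf{e}_\theta)\,d\theta$ with $\mathbf{e}_\theta = (\cos\theta,\sin\theta)$.) Here $\|\cdot\|$ is the Euclidean norm. *)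

theory Defs
  imports "HOL-Probability.Probability"
begin

definition walk :: "(nat \<Rightarrow> 'a \<Rightarrow> real^2) \<Rightarrow> nat \<Rightarrow> 'a \<Rightarrow> real^2" where
  "walk Z n \<omega> = (\<Sum>k=1..n. Z k \<omega>)"

(* Meant for convex polygons K in the plane, possibly degenerate. A two-dimensional polygon has
   as perimeter the sum of the lengths of its sides; the diameter of a side is its length.
   By convention a line segment counts twice, and a point has perimeter 0. *)
definition perimeter :: "(real^2) set \<Rightarrow> real" where
  "perimeter K = (if aff_dim K = 2 then \<Sum>e | e edge_of K. diameter e else 2 * diameter K)"

definition hull_perimeter :: "(nat \<Rightarrow> 'a \<Rightarrow> real^2) \<Rightarrow> nat \<Rightarrow> 'a \<Rightarrow> real" where
  "hull_perimeter Z n \<omega> = perimeter (convex hull ((\<lambda>k. walk Z k \<omega>) ` {0..n}))"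

(* Square-integrability is part of the notion: the Bochner integral of a non-integrable function
   is 0, so convergence of the integrals alone would say too little. *)
definition tendsto_L2 :: "'a measure \<Rightarrow> (nat \<Rightarrow> 'a \<Rightarrow> real) \<Rightarrow> ('a \<Rightarrow> real) \<Rightarrow> bool" where
  "tendsto_L2 M Y Y' \<longleftrightarrow>
     (\<forall>n. Y n \<in> borel_measurable M \<and> integrable M (\<lambda>\<omega>. (Y n \<omega>)\<^sup>2)) \<and>
     Y' \<in> borel_measurable M \<and> integrable M (\<lambda>\<omega>. (Y' \<omega>)\<^sup>2) \<and>
     (\<lambda>n. \<integral>\<omega>. (Y n \<omega> - Y' \<omega>)\<^sup>2 \<partial>M) \<longlonglongrightarrow> 0"

(* The family is indexed from 0: Z 0 is the generic increment Z of the i.i.d. family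
   Z, Z_1, Z_2, ..., and is not a step of the walk. *)
definition iid :: "'a measure \<Rightarrow> (nat \<Rightarrow> 'a \<Rightarrow> real^2) \<Rightarrow> bool" where
  "iid M Z \<longleftrightarrow> prob_space.indep_vars M (\<lambda>_. borel) Z UNIV \<and>
     (\<forall>k. distr M borel (Z k) = distr M borel (Z 0))"

lemma perimeter_closed_segment: "perimeter (closed_segment a b) = 2 * dist a b"
proof -
  have "aff_dim (closed_segment a b) \<noteq> 2"
  proof -
    have "aff_dim (closed_segment a b) = aff_dim {a, b}"
      by (simp add: segment_convex_hull aff_dim_convex_hull)
    also have "\<dots> \<le> 1" by (simp add: aff_dim_2)
    finally show ?thesis by simp
  qed
  moreover have "diameter (closed_segment a b) = dist a b"
  proof (rule antisym)
    have "dist x y \<le> dist a b" if xy: "x \<in> closed_segment a b" "y \<in> closed_segment a b" for x y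
    proof -
      obtain u v where "u \<in> {a, b}" "v \<in> {a, b}" "norm (x - y) \<le> norm (u - v)"
        using simplex_extremal_le[of "{a, b}"] xy[unfolded segment_convex_hull]
        by (metis finite.emptyI finite.insertI insert_not_empty)
      then show ?thesis
        by (auto simp: dist_norm norm_minus_commute intro: order.trans)
    qed
    then show "diameter (closed_segment a b) \<le> dist a b"
      by (intro diameter_le) (auto simp: dist_norm)
    show "dist a b \<le> diameter (closed_segment a b)"
      by (intro diameter_bounded_bound) (auto simp: bounded_closed_segment)
  qed
  ultimately show ?thesis by (simp add: perimeter_def)
qed

end

theory Submission
  imports Defs
begin

text \<open>Let \<open>p = \<mu> / \<parallel>\<mu>\<parallel>\<close> and let \<open>e(\<theta>) = cos \<theta> p + sin \<theta> p'\<close> with \<open>p'\<close> the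
quarter turn of \<open>p\<close>; these are the directions used for \<open>-\<pi>/2 \<le> \<theta> \<le> \<pi>/2\<close>, exactly the half circle
on which the drift \<open>\<mu> \<bullet> e(\<theta>) = \<parallel>\<mu>\<parallel> cos \<theta>\<close> is nonnegative.

By Cauchy's formula (\<open>Cauchy_perimeter\<close>) the perimeter of a convex polygon is the integral of its
width over a half circle, and \<open>2 v \<bullet> p\<close> is the integral of \<open>v \<bullet> e(\<theta>)\<close> over the same half circle.
Therefore \<open>L\<^sub>n - 2 S\<^sub>n \<bullet> p\<close> is the integral of the gap
\<open>G\<^sub>n(\<theta>) = (max\<^sub>k S\<^sub>k \<bullet> e(\<theta>) - S\<^sub>n \<bullet> e(\<theta>)) + (- min\<^sub>k S\<^sub>k \<bullet> e(\<theta>)) \<ge> 0\<close>.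
Both terms are maxima of one-dimensional walks with drift \<open>- \<mu> \<bullet> e(\<theta>)\<close>, the first one read backwards
from time \<open>n\<close>. Such maxima satisfy the recursion \<open>R' = max 0 (R + X)\<close>, with \<open>X\<close> independent of \<open>R\<close>
(for the second term after reversing the order of the steps).
If the drift is at most \<open>0\<close>, then \<open>E R'\<^sup>2 \<le> E R\<^sup>2 + E X\<^sup>2\<close>, so the second moment is \<open>O(n)\<close>.
If the drift is negative, it is even \<open>o(n)\<close> (\<open>lindley_negative_drift\<close>): the steps are split into a part that
is bounded above and keeps the negative drift, for which \<open>R\<close> has a bounded exponential moment, and
a centred remainder of small variance, to which the \<open>O(n)\<close> bound applies.

The Cauchy-Schwarz inequality and Tonelli's theorem then give
\<open>E (L\<^sub>n - 2 S\<^sub>n \<bullet> p)\<^sup>2 / n \<le> \<pi> \<integral> E G\<^sub>n(\<theta>)\<^sup>2 / n d\<theta>\<close>. The integrand is bounded uniformly in \<open>n\<close> and \<open>\<theta>\<close>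
and tends to \<open>0\<close> for \<open>\<bar>\<theta>\<bar> < \<pi>/2\<close>, so dominated convergence concludes. The formula for
\<open>L\<^sub>n\<close> as an integral also shows that \<open>L\<^sub>n\<close> is measurable.\<close>

section \<open>Lines meeting a convex polygon\<close>

definition perp :: "real^2 \<Rightarrow> real^2" where
  "perp u = vector [- (u $ 2), u $ 1]"

lemma inner_vec2: "(x::real^2) \<bullet> y = x $ 1 * y $ 1 + x $ 2 * y $ 2"
  by (simp add: inner_vec_def sum_2)

lemma inner_perp [simp]: "u \<bullet> perp u = 0"
  by (simp add: inner_vec2 perp_def)

lemma norm_perp [simp]: "norm (perp u) = norm u"
  by (simp add: norm_eq_sqrt_inner inner_vec2 perp_def)

lemma perp_eq_0_iff [simp]: "perp u = 0 \<longleftrightarrow> u = 0"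
  by (metis norm_perp norm_eq_zero)

text \<open>A chord of a plane convex body at a level strictly between two attained levels passes through an interior point
\<open>z\<close>, and its two end points lie outside the interior, because from an interior point one can
move along the line in both directions.\<close>
lemma line_meets_polygon_segment:
  fixes K :: "(real^2) set"
  assumes "compact K" "convex K" "aff_dim K = 2"
    and "x \<in> K" "x \<bullet> u < t" and "y \<in> K" "t < y \<bullet> u"
  obtains p q z where "K \<inter> {x. x \<bullet> u = t} = closed_segment p q"
    "p \<notin> interior K" "q \<notin> interior K" "z \<in> interior K" "z \<in> open_segment p q"
proof -
  let ?H = "{x. x \<bullet> u = t}"
  have u: "u \<noteq> 0" using assms by auto
  have "interior K \<noteq> {}"
  proof -
    have "interior K = rel_interior K"
      using assms(3) aff_dim_eq_full[of K] by (intro rel_interior_interior[symmetric]) auto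
    then show ?thesis using assms(2,4) rel_interior_eq_empty by auto
  qed
  then obtain i where i: "i \<in> interior K" by auto
  have cross: "\<exists>z \<in> interior K. z \<bullet> u = t" if w: "w \<in> K" "(i \<bullet> u - t) * (w \<bullet> u - t) < 0" for w
  proof -
    let ?a = "i \<bullet> u - t" and ?b = "w \<bullet> u - t"
    define s where "s = ?a / (?a - ?b)"
    have ab: "?a - ?b \<noteq> 0" using w(2) by (auto simp: mult_less_0_iff)
    have s: "0 < s" "s < 1"
      using w(2) unfolding s_def mult_less_0_iff zero_less_divide_iff divide_less_eq by auto
    have eq: "s * (?a - ?b) = ?a" using ab by (simp add: s_def)
    define z where "z = (1 - s) *\<^sub>R i + s *\<^sub>R w"
    have "z \<in> open_segment i w"
      using s ab w(2) by (auto simp: in_segment z_def)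
    then have "z \<in> interior K"
      using in_interior_closure_convex_segment[OF assms(2) i] closure_subset w(1) by blast
    moreover have "z \<bullet> u = t"
      using eq by (simp add: z_def inner_add_left algebra_simps)
    ultimately show ?thesis by blast
  qed
  \<comment> \<open>An interior point of \<open>K\<close> at level \<open>t\<close> lies on the segment from \<open>i\<close> to \<open>x\<close> or \<open>y\<close>, whichever is on the other side of the line.\<close>
  have "\<exists>z \<in> interior K. z \<bullet> u = t"
  proof (cases "i \<bullet> u" t rule: linorder_cases)
    case less
    then show ?thesis using cross[of y] assms by (auto simp: mult_less_0_iff)
  next
    case equal
    then show ?thesis using i by auto
  next
    case greater
    then show ?thesis using cross[of x] assms by (auto simp: mult_less_0_iff)
  qed
  then obtain z where z: "z \<in> interior K" "z \<bullet> u = t" by auto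
  have "aff_dim (K \<inter> ?H) \<le> aff_dim ?H" by (intro aff_dim_subset) auto
  also have "\<dots> = 1" using aff_dim_hyperplane[of u t] u by (simp add: inner_commute)
  finally have col: "collinear (K \<inter> ?H)" by (simp add: collinear_aff_dim)
  have "z \<in> K" using z interior_subset by auto
  then have "K \<inter> ?H \<noteq> {}" using z by auto
  moreover have "compact (K \<inter> ?H)" "convex (K \<inter> ?H)"
  proof -
    have H: "?H = {x. u \<bullet> x = t}" by (simp add: inner_commute)
    show "compact (K \<inter> ?H)" unfolding H
      by (intro compact_Int_closed assms closed_hyperplane)
    show "convex (K \<inter> ?H)" unfolding H
      by (intro convex_Int assms convex_hyperplane)
  qed
  ultimately obtain p q where pq: "K \<inter> ?H = closed_segment p q"
    using compact_convex_collinear_segment col by metis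
  \<comment> \<open>From an interior point one can move a little in both directions along the line.\<close>
  have not_ext: "w \<notin> interior K" if w: "w extreme_point_of closed_segment p q" for w
  proof
    assume wi: "w \<in> interior K"
    then obtain r where r: "r > 0" "cball w r \<subseteq> K" by (auto simp: mem_interior_cball)
    have wt: "w \<bullet> u = t" using w pq by (auto simp: extreme_point_of_def)
    define d where "d = (r / norm (perp u)) *\<^sub>R perp u"
    have d: "norm d = r" "d \<bullet> u = 0" using r u by (auto simp: d_def inner_commute)
    have mem: "w + d \<in> closed_segment p q" "w - d \<in> closed_segment p q"
      using r d wt by (auto simp: pq[symmetric] inner_add_left inner_diff_left dist_norm subset_iff)
    have "w \<in> open_segment (w + d) (w - d)"
    proof -
      have "w = midpoint (w + d) (w - d)" by (simp add: midpoint_def scaleR_add_right flip: scaleR_left_distrib)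
      moreover have "w + d \<noteq> w - d"
      proof
        assume "w + d = w - d"
        then have "2 *\<^sub>R d = 0" by (simp add: scaleR_2)
        then show False using d r by auto
      qed
      ultimately show ?thesis by (metis midpoint_in_open_segment)
    qed
    then show False using w mem by (auto simp: extreme_point_of_def)
  qed
  have p: "p \<notin> interior K" and q: "q \<notin> interior K"
    using not_ext by (auto simp: extreme_point_of_segment)
  have "z \<in> closed_segment p q" using z \<open>z \<in> K\<close> pq by blast
  then have "z \<in> open_segment p q" using p q z by (auto simp: open_segment_def)
  then show thesis using that[OF pq p q z(1)] by blast
qed

text \<open>Two different edges through \<open>p\<close> would intersect in a face of dimension \<open>0\<close>, which makes \<open>p\<close> a vertex.\<close>
lemma frontier_point_on_unique_edge:
  fixes K :: "(real^2) set"
  assumes K: "polytope K" "aff_dim K = 2"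
    and p: "p \<in> K" "p \<notin> interior K" "\<not> p extreme_point_of K"
  shows "\<exists>!e. e edge_of K \<and> p \<in> e"
proof -
  have "rel_frontier K = frontier K"
    using K(2) aff_dim_eq_full[of K] by (intro rel_frontier_frontier) auto
  moreover have "p \<in> frontier K"
    using p closure_subset by (auto simp: frontier_def)
  ultimately have "p \<in> \<Union> {F. F facet_of K}"
    using rel_frontier_of_polyhedron[OF polytope_imp_polyhedron[OF K(1)]] by simp
  then obtain e where e: "e edge_of K" "p \<in> e"
    using K(2) by (auto simp: facet_of_def edge_of_def)
  have "e' = e" if e': "e' edge_of K" "p \<in> e'" for e'
  proof (rule ccontr)
    assume ne: "e' \<noteq> e"
    have F: "e \<inter> e' face_of K" using e e' by (auto simp: edge_of_def intro: face_of_Int)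
    have "aff_dim (e \<inter> e') < 1"
    proof (cases "e \<inter> e' = e")
      case True
      have "e face_of e'" using e e' True
        by (metis edge_of_def edge_of_imp_subset face_of_subset inf.orderI inf_commute)
      moreover have "convex e'" using e' by (auto simp: edge_of_def intro: face_of_imp_convex)
      ultimately have "aff_dim e < aff_dim e'" using face_of_aff_dim_lt ne by blast
      then show ?thesis using e e' by (auto simp: edge_of_def)
    next
      case False
      have "e \<inter> e' face_of e" using F e
        by (metis edge_of_imp_subset face_of_subset inf.cobounded1)
      moreover have "convex e" using e by (auto simp: edge_of_def intro: face_of_imp_convex)
      ultimately have "aff_dim (e \<inter> e') < aff_dim e" using face_of_aff_dim_lt False by blast
      then show ?thesis using e by (auto simp: edge_of_def)
    qed
    moreover have "e \<inter> e' \<noteq> {}" using e e' by auto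
    then have "aff_dim (e \<inter> e') \<noteq> -1" by (simp add: aff_dim_empty)
    moreover have "aff_dim (e \<inter> e') \<ge> -1" by (rule aff_dim_geq)
    ultimately have "aff_dim (e \<inter> e') = 0" by linarith
    then obtain a where a: "e \<inter> e' = {a}" by (auto simp: aff_dim_eq_0)
    moreover have "p \<in> e \<inter> e'" using e e' by blast
    ultimately have "e \<inter> e' = {p}" by simp
    then show False using F p(3) by (simp add: face_of_singleton)
  qed
  then show ?thesis using e by blast
qed

text \<open>The line crosses the frontier in the two end points of the chord, each on exactly one edge. The two edges
differ, and no edge is met inside the chord, since otherwise an edge would contain both end points and hence
an interior point of the polygon.\<close>
lemma card_edges_meeting_line:
  fixes K :: "(real^2) set"
  assumes K: "polytope K" "aff_dim K = 2"
    and lev: "x \<in> K" "x \<bullet> u < t" "y \<in> K" "t < y \<bullet> u"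
    and gen: "\<And>v. v extreme_point_of K \<Longrightarrow> v \<bullet> u \<noteq> t"
  shows "card {e. e edge_of K \<and> t \<in> (\<lambda>x. x \<bullet> u) ` e} = 2"
proof -
  have cK: "compact K" "convex K"
    using K(1) by (auto simp: polytope_imp_compact polytope_imp_convex)
  obtain p q z where pq: "K \<inter> {x. x \<bullet> u = t} = closed_segment p q"
    "p \<notin> interior K" "q \<notin> interior K" "z \<in> interior K" "z \<in> open_segment p q"
    using line_meets_polygon_segment[OF cK K(2) lev] by metis
  have pK: "p \<in> K" "p \<bullet> u = t" "q \<in> K" "q \<bullet> u = t" using pq(1) by auto
  have zn: "z \<notin> e" if "e edge_of K" for e
    using that pq(4) face_of_disjoint_interior[of e K] K(2) by (fastforce simp: edge_of_def)
  obtain ep where ep: "ep edge_of K" "p \<in> ep" "\<And>e. e edge_of K \<Longrightarrow> p \<in> e \<Longrightarrow> e = ep"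
    using frontier_point_on_unique_edge[OF K, of p] pK pq gen by blast
  obtain eq where eq: "eq edge_of K" "q \<in> eq" "\<And>e. e edge_of K \<Longrightarrow> q \<in> e \<Longrightarrow> e = eq"
    using frontier_point_on_unique_edge[OF K, of q] pK pq gen by blast
  have not_both: False if e: "e edge_of K" "p \<in> e" "q \<in> e" for e
  proof -
    have "convex e" using e by (auto simp: edge_of_def intro: face_of_imp_convex)
    then have "z \<in> e" using pq(5) e(2,3) convex_contains_open_segment by blast
    then show False using zn e by blast
  qed
  have "{e. e edge_of K \<and> t \<in> (\<lambda>x. x \<bullet> u) ` e} = {ep, eq}"
  proof (intro equalityI subsetI)
    fix e assume "e \<in> {e. e edge_of K \<and> t \<in> (\<lambda>x. x \<bullet> u) ` e}"
    then obtain w where w: "e edge_of K" "w \<in> e" "w \<bullet> u = t" by auto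
    then have "w \<in> closed_segment p q"
      using pq(1) edge_of_imp_subset by blast
    moreover have "w \<notin> open_segment p q"
      using w face_ofD[of e K w p q] pK not_both[of e] by (auto simp: edge_of_def)
    ultimately have "w = p \<or> w = q" by (auto simp: open_segment_def)
    then show "e \<in> {ep, eq}" using ep(3)[OF w(1)] eq(3)[OF w(1)] w(2) by auto
  next
    fix e assume "e \<in> {ep, eq}"
    moreover have "t \<in> (\<lambda>x. x \<bullet> u) ` ep"
      using imageI[OF ep(2), of "\<lambda>x. x \<bullet> u"] by (simp only: pK(2))
    moreover have "t \<in> (\<lambda>x. x \<bullet> u) ` eq"
      using imageI[OF eq(2), of "\<lambda>x. x \<bullet> u"] by (simp only: pK(4))
    ultimately show "e \<in> {e. e edge_of K \<and> t \<in> (\<lambda>x. x \<bullet> u) ` e}"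
      using ep(1) eq(1) by auto
  qed
  moreover have "ep \<noteq> eq" using not_both[of ep] ep(1,2) eq(2) by auto
  ultimately show ?thesis by simp
qed

section \<open>Widths of polygons and of their edges\<close>

definition shadow :: "(real^2) set \<Rightarrow> real^2 \<Rightarrow> real set" where
  "shadow K u = (\<lambda>x. x \<bullet> u) ` K"

definition width :: "(real^2) set \<Rightarrow> real^2 \<Rightarrow> real" where
  "width K u = measure lborel (shadow K u)"

lemma linear_inner_left: "linear (\<lambda>x::real^2. x \<bullet> u)"
  by (intro linearI) (auto simp: inner_add_left)

lemma shadow_hull:
  assumes "finite F" "F \<noteq> {}"
  shows "shadow (convex hull F) u = {Min ((\<lambda>x. x \<bullet> u) ` F)..Max ((\<lambda>x. x \<bullet> u) ` F)}"
proof -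
  let ?A = "(\<lambda>x. x \<bullet> u) ` F"
  have fin: "finite ?A" "?A \<noteq> {}" using assms by auto
  have "shadow (convex hull F) u = convex hull ?A"
    unfolding shadow_def by (rule convex_hull_linear_image[OF linear_inner_left])
  also have "\<dots> = {Min ?A..Max ?A}"
  proof
    show "convex hull ?A \<subseteq> {Min ?A..Max ?A}"
      using fin by (intro hull_minimal) auto
    have "closed_segment (Min ?A) (Max ?A) \<subseteq> convex hull ?A"
      using fin by (intro closed_segment_subset_convex_hull hull_inc Min_in Max_in)
    then show "{Min ?A..Max ?A} \<subseteq> convex hull ?A"
      using Min_le[OF fin(1) Max_in[OF fin]] by (simp only: closed_segment_eq_real_ivl1)
  qed
  finally show ?thesis .
qed

lemma width_hull:
  assumes "finite F" "F \<noteq> {}"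
  shows "width (convex hull F) u = Max ((\<lambda>x. x \<bullet> u) ` F) - Min ((\<lambda>x. x \<bullet> u) ` F)"
proof -
  have "Min ((\<lambda>x. x \<bullet> u) ` F) \<le> Max ((\<lambda>x. x \<bullet> u) ` F)"
    using assms by (meson Max_in Min_le finite_imageI image_is_empty)
  then show ?thesis using shadow_hull[OF assms] by (simp add: width_def)
qed

lemma width_segment: "width (closed_segment a b) u = \<bar>(a - b) \<bullet> u\<bar>"
  unfolding segment_convex_hull by (subst width_hull) (auto simp: inner_diff_left max_def min_def)

lemma shadow_polytope:
  assumes "polytope K" "K \<noteq> {}"
  obtains m M where "m \<le> M" "shadow K u = {m..M}"
proof -
  obtain F where F: "finite F" "K = convex hull F"
    using assms by (auto simp: polytope_def)
  then have "F \<noteq> {}" using assms by auto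
  moreover have "Min ((\<lambda>x. x \<bullet> u) ` F) \<le> Max ((\<lambda>x. x \<bullet> u) ` F)"
    using F \<open>F \<noteq> {}\<close> by (meson Max_in Min_le finite_imageI image_is_empty)
  ultimately show ?thesis using that shadow_hull[of F u] F by blast
qed

lemma flat_polytope_segment:
  fixes K :: "'a::euclidean_space set"
  assumes "polytope K" "K \<noteq> {}" "aff_dim K \<le> 1"
  obtains a b where "K = closed_segment a b"
  using assms compact_convex_collinear_segment[of K]
  by (metis collinear_aff_dim polytope_imp_compact polytope_imp_convex)

text \<open>Both sides are integrals over the levels \<open>t\<close>: the left one of the number of edges met by the line at level
\<open>t\<close>, the right one of \<open>2\<close> on the shadow of \<open>K\<close>. These agree except at the finitely many levels of the
vertices and at the two end points of the shadow.\<close>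
lemma sum_width_edges:
  assumes K: "polytope K" "aff_dim K = 2"
  shows "(\<Sum>e | e edge_of K. width e u) = 2 * width K u"
proof -
  have ne: "K \<noteq> {}" using K by auto
  have finE: "finite {e. e edge_of K}"
    by (rule finite_subset[OF _ finite_polytope_faces[OF K(1)]]) (auto simp: edge_of_def)
  have edge: "polytope e" "e \<noteq> {}" if "e edge_of K" for e
    using that K by (auto simp: edge_of_def intro: face_of_polytope_polytope)
  obtain m M where mM: "m \<le> M" "shadow K u = {m..M}" using shadow_polytope[OF K(1) ne] by metis
  have sh: "shadow e u \<in> sets lborel" "emeasure lborel (shadow e u) < \<infinity>" if "e edge_of K" for e
    using shadow_polytope[of e u] edge[OF that] by (metis atLeastAtMost_borel sets_lborel, metis emeasure_lborel_Icc ennreal_less_top infinity_ennreal_def)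
  let ?N = "\<lambda>t. \<Sum>e | e edge_of K. indicator (shadow e u) t :: real"
  let ?lev = "insert m (insert M ((\<lambda>x. x \<bullet> u) ` {v. v extreme_point_of K}))"
  have "finite {v. v extreme_point_of K}" using K(1) by (simp add: finite_polyhedron_extreme_points polytope_imp_polyhedron)
  then have "finite ?lev" by auto
  then have null: "AE t in lborel. t \<notin> ?lev"
    by (intro AE_not_in finite_imp_null_set_lborel)
  have count: "?N t = 2 * indicator {m..M} t" if t: "t \<notin> ?lev" for t
  proof (cases "t \<in> {m..M}")
    case True
    then have t': "m < t" "t < M" using t by auto
    have "m \<in> shadow K u" "M \<in> shadow K u" using mM by auto
    then obtain x y where xy: "x \<in> K" "x \<bullet> u = m" "y \<in> K" "y \<bullet> u = M" by (auto simp: shadow_def)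
    have "card {e. e edge_of K \<and> t \<in> (\<lambda>x. x \<bullet> u) ` e} = 2"
      by (rule card_edges_meeting_line[OF K, of x u t y]) (use xy t' t in auto)
    moreover have "?N t = real (card {e. e edge_of K \<and> t \<in> (\<lambda>x. x \<bullet> u) ` e})"
      using finE by (simp add: indicator_def shadow_def sum.If_cases Collect_conj_eq)
    ultimately show ?thesis using True by simp
  next
    case False
    have "indicator (shadow e u) t = (0::real)" if "e edge_of K" for e
    proof -
      have "shadow e u \<subseteq> {m..M}"
        unfolding mM(2)[symmetric] shadow_def using edge_of_imp_subset[OF that] by (rule image_mono)
      then show ?thesis using False by (auto simp: indicator_def)
    qed
    then show ?thesis using False by simp
  qed
  have "(\<Sum>e | e edge_of K. width e u) = (\<Sum>e | e edge_of K. \<integral>t. indicator (shadow e u) t \<partial>lborel)"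
    by (simp add: width_def)
  also have "\<dots> = (\<integral>t. ?N t \<partial>lborel)"
    by (intro Bochner_Integration.integral_sum[symmetric]) (use sh in auto)
  also have "\<dots> = (\<integral>t. 2 * indicator {m..M} t \<partial>lborel)"
  proof (rule integral_cong_AE)
    show "?N \<in> borel_measurable lborel" using sh by (intro borel_measurable_sum borel_measurable_indicator) auto
    show "AE t in lborel. ?N t = 2 * indicator {m..M} t"
      using null by eventually_elim (rule count)
  qed auto
  also have "\<dots> = 2 * width K u" by (simp add: width_def mM)
  finally show ?thesis .
qed

section \<open>Cauchy's perimeter formula\<close>

definition dir :: "real^2 \<Rightarrow> real \<Rightarrow> real^2" where
  "dir p \<theta> = cos \<theta> *\<^sub>R p + sin \<theta> *\<^sub>R perp p"

lemma norm_dir: "norm (dir p \<theta>) = norm p"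
proof -
  have "perp p \<bullet> perp p = p \<bullet> p" by (simp add: inner_vec2 perp_def)
  then have "dir p \<theta> \<bullet> dir p \<theta> = ((cos \<theta>)\<^sup>2 + (sin \<theta>)\<^sup>2) * (p \<bullet> p)"
    unfolding dir_def
    by (simp add: inner_add_left inner_add_right inner_commute power2_eq_square distrib_right del: sin_cos_squared_add sin_cos_squared_add2 sin_cos_squared_add3)
  then have "(norm (dir p \<theta>))\<^sup>2 = (norm p)\<^sup>2" by (simp add: power2_norm_eq_inner)
  then show ?thesis by (simp add: power2_eq_iff_nonneg)
qed

lemma inner_dir_self:
  assumes "norm p = 1"
  shows "p \<bullet> dir p \<theta> = cos \<theta>"
  using assms by (simp add: dir_def inner_add_right norm_eq_1)

lemma has_integral_inner_dir:
  "((\<lambda>\<theta>. v \<bullet> dir p \<theta>) has_integral 2 * (v \<bullet> p)) {-pi/2..pi/2}"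
proof -
  have "((\<lambda>\<theta>. (v \<bullet> p) * cos \<theta> + (v \<bullet> perp p) * sin \<theta>) has_integral
      ((v \<bullet> p) * sin (pi/2) - (v \<bullet> perp p) * cos (pi/2)) -
      ((v \<bullet> p) * sin (-pi/2) - (v \<bullet> perp p) * cos (-pi/2))) {-pi/2..pi/2}"
    by (intro fundamental_theorem_of_calculus)
      (auto simp flip: has_real_derivative_iff_has_vector_derivative intro!: derivative_eq_intros)
  then show ?thesis by (simp add: dir_def inner_add_right mult.commute)
qed

text \<open>The interval has length \<open>\<pi>\<close>, so \<open>cos (\<theta> - \<psi>)\<close> changes sign in it at most once: at \<open>\<psi> - \<pi>/2\<close> or at
\<open>\<psi> + \<pi>/2\<close>, depending on the sign of \<open>\<psi>\<close>.\<close>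
lemma has_integral_abs_cos_shift:
  assumes "\<bar>\<psi>\<bar> \<le> pi/2"
  shows "((\<lambda>\<theta>. \<bar>cos (\<theta> - \<psi>)\<bar>) has_integral 2) {-pi/2..pi/2}"
proof -
  have pos: "((\<lambda>\<theta>. cos (\<theta> - \<psi>)) has_integral sin (b - \<psi>) - sin (a - \<psi>)) {a..b}" if "a \<le> b" for a b
    using that by (intro fundamental_theorem_of_calculus)
      (auto simp flip: has_real_derivative_iff_has_vector_derivative intro!: derivative_eq_intros)
  have neg: "((\<lambda>\<theta>. - cos (\<theta> - \<psi>)) has_integral sin (a - \<psi>) - sin (b - \<psi>)) {a..b}" if "a \<le> b" for a b
    using has_integral_neg[OF pos[OF that]] by simp
  have s: "sin (pi/2 - \<psi>) = cos \<psi>" "sin (-pi/2 - \<psi>) = - cos \<psi>"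
    by (auto simp: sin_diff)
  show ?thesis
  proof (cases "\<psi> \<ge> 0")
    case True
    define c where "c = \<psi> - pi/2"
    have c: "-pi/2 \<le> c" "c \<le> pi/2" using True assms by (auto simp: c_def)
    have "((\<lambda>\<theta>. \<bar>cos (\<theta> - \<psi>)\<bar>) has_integral sin (-pi/2 - \<psi>) - sin (c - \<psi>)) {-pi/2..c}"
    proof (rule has_integral_eq[OF _ neg[OF c(1)]])
      fix \<theta> assume "\<theta> \<in> {-pi/2..c}"
      then have "0 \<le> cos (\<theta> - \<psi> + pi)" using assms by (intro cos_ge_zero) (auto simp: c_def)
      then show "- cos (\<theta> - \<psi>) = \<bar>cos (\<theta> - \<psi>)\<bar>" by simp
    qed
    moreover have "((\<lambda>\<theta>. \<bar>cos (\<theta> - \<psi>)\<bar>) has_integral sin (pi/2 - \<psi>) - sin (c - \<psi>)) {c..pi/2}"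
    proof (rule has_integral_eq[OF _ pos[OF c(2)]])
      fix \<theta> assume "\<theta> \<in> {c..pi/2}"
      then have "0 \<le> cos (\<theta> - \<psi>)" using True by (intro cos_ge_zero) (auto simp: c_def)
      then show "cos (\<theta> - \<psi>) = \<bar>cos (\<theta> - \<psi>)\<bar>" by simp
    qed
    ultimately have "((\<lambda>\<theta>. \<bar>cos (\<theta> - \<psi>)\<bar>) has_integral (sin (-pi/2 - \<psi>) - sin (c - \<psi>)) + (sin (pi/2 - \<psi>) - sin (c - \<psi>))) {-pi/2..pi/2}"
      by (intro has_integral_combine[OF c])
    then show ?thesis unfolding s by (simp add: c_def)
  next
    case False
    define c where "c = \<psi> + pi/2"
    have c: "-pi/2 \<le> c" "c \<le> pi/2" using False assms by (auto simp: c_def)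
    have "((\<lambda>\<theta>. \<bar>cos (\<theta> - \<psi>)\<bar>) has_integral sin (c - \<psi>) - sin (-pi/2 - \<psi>)) {-pi/2..c}"
    proof (rule has_integral_eq[OF _ pos[OF c(1)]])
      fix \<theta> assume "\<theta> \<in> {-pi/2..c}"
      then have "0 \<le> cos (\<theta> - \<psi>)" using False by (intro cos_ge_zero) (auto simp: c_def)
      then show "cos (\<theta> - \<psi>) = \<bar>cos (\<theta> - \<psi>)\<bar>" by simp
    qed
    moreover have "((\<lambda>\<theta>. \<bar>cos (\<theta> - \<psi>)\<bar>) has_integral sin (c - \<psi>) - sin (pi/2 - \<psi>)) {c..pi/2}"
    proof (rule has_integral_eq[OF _ neg[OF c(2)]])
      fix \<theta> assume "\<theta> \<in> {c..pi/2}"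
      then have "0 \<le> cos (\<theta> - \<psi> - pi)" using assms by (intro cos_ge_zero) (auto simp: c_def)
      then show "- cos (\<theta> - \<psi>) = \<bar>cos (\<theta> - \<psi>)\<bar>" by (simp add: cos_diff[of _ pi])
    qed
    ultimately have "((\<lambda>\<theta>. \<bar>cos (\<theta> - \<psi>)\<bar>) has_integral (sin (c - \<psi>) - sin (-pi/2 - \<psi>)) + (sin (c - \<psi>) - sin (pi/2 - \<psi>))) {-pi/2..pi/2}"
      by (intro has_integral_combine[OF c])
    then show ?thesis unfolding s by (simp add: c_def)
  qed
qed

text \<open>This is Cauchy's formula for a segment. In the orthonormal frame \<open>p\<close>, \<open>perp p\<close> and up to the sign of \<open>v\<close>,
\<open>v = \<parallel>v\<parallel> (cos \<psi>, sin \<psi>)\<close> with \<open>\<bar>\<psi>\<bar> \<le> \<pi>/2\<close>.\<close>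
lemma has_integral_abs_inner_dir:
  assumes "norm p = 1"
  shows "((\<lambda>\<theta>. \<bar>v \<bullet> dir p \<theta>\<bar>) has_integral 2 * norm v) {-pi/2..pi/2}"
proof -
  have main: "((\<lambda>\<theta>. \<bar>v \<bullet> dir p \<theta>\<bar>) has_integral 2 * norm v) {-pi/2..pi/2}" if "v \<bullet> p \<ge> 0" for v
  proof (cases "v = 0")
    case False
    define a b where "a = v \<bullet> p" and "b = v \<bullet> perp p"
    have "(p $ 1)\<^sup>2 + (p $ 2)\<^sup>2 = 1"
      using assms by (simp add: norm_eq_sqrt_inner inner_vec2 power2_eq_square)
    then have "a\<^sup>2 + b\<^sup>2 = (norm v)\<^sup>2"
      unfolding a_def b_def power2_norm_eq_inner inner_vec2 perp_def by simp algebra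
    then have "(a / norm v)\<^sup>2 + (b / norm v)\<^sup>2 = 1"
      using False by (simp add: power_divide flip: add_divide_distrib)
    moreover have "0 \<le> a / norm v" using that by (simp add: a_def)
    ultimately obtain \<psi> where \<psi>: "-pi/2 \<le> \<psi>" "\<psi> \<le> pi/2" "a / norm v = cos \<psi>" "b / norm v = sin \<psi>"
    proof -
      assume sq: "(a / norm v)\<^sup>2 + (b / norm v)\<^sup>2 = 1" and pos: "0 \<le> a / norm v"
        and th: "\<And>\<psi>. -pi/2 \<le> \<psi> \<Longrightarrow> \<psi> \<le> pi/2 \<Longrightarrow> a / norm v = cos \<psi> \<Longrightarrow> b / norm v = sin \<psi> \<Longrightarrow> thesis"
      have "\<bar>b / norm v\<bar> \<le> 1" using sq
        by (metis abs_square_le_1 le_add_same_cancel2 zero_le_power2)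
      then have b1: "-1 \<le> b / norm v" "b / norm v \<le> 1" by linarith+
      have "cos (arcsin (b / norm v)) = sqrt (1 - (b / norm v)\<^sup>2)" using b1 by (rule cos_arcsin)
      also have "\<dots> = a / norm v" using sq pos by (metis add_diff_cancel_right' real_sqrt_unique)
      finally show thesis using arcsin_bounded[OF b1] arcsin[OF b1] by (intro th[of "arcsin (b / norm v)"]) auto
    qed
    have "v \<bullet> dir p \<theta> = norm v * cos (\<theta> - \<psi>)" for \<theta>
    proof -
      have "a = norm v * cos \<psi>" "b = norm v * sin \<psi>" using \<psi>(3,4) False by (auto simp: field_simps)
      then show ?thesis by (simp add: dir_def inner_add_right a_def[symmetric] b_def[symmetric] cos_diff algebra_simps)
    qed
    moreover have "((\<lambda>\<theta>. norm v * \<bar>cos (\<theta> - \<psi>)\<bar>) has_integral norm v * 2) {-pi/2..pi/2}"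
      using \<psi> by (intro has_integral_mult_right has_integral_abs_cos_shift) auto
    ultimately show ?thesis by (simp add: abs_mult mult.commute[of _ 2])
  qed simp
  show ?thesis
  proof (cases "v \<bullet> p \<ge> 0")
    case False
    then show ?thesis using main[of "- v"] by simp
  qed (rule main)
qed

text \<open>The formula holds for every edge, being a segment, and summing over the edges counts the width of \<open>K\<close>
twice. A polygon of lower dimension is itself a segment, whose length is counted twice in the perimeter by
convention.\<close>
theorem Cauchy_perimeter:
  assumes p: "norm p = 1" and K: "polytope K" "K \<noteq> {}"
  shows "((\<lambda>\<theta>. width K (dir p \<theta>)) has_integral perimeter K) {-pi/2..pi/2}"
proof (cases "aff_dim K = 2")
  case True
  have edge: "((\<lambda>\<theta>. width e (dir p \<theta>)) has_integral 2 * diameter e) {-pi/2..pi/2}" if e: "e edge_of K" for e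
  proof -
    have "polytope e" "e \<noteq> {}" "aff_dim e \<le> 1"
      using e K by (auto simp: edge_of_def intro: face_of_polytope_polytope)
    then obtain a b where ab: "e = closed_segment a b" using flat_polytope_segment by blast
    have "perimeter e = 2 * diameter e" using e by (simp add: perimeter_def edge_of_def)
    then have "2 * diameter e = 2 * norm (a - b)" using ab by (simp add: perimeter_closed_segment dist_norm)
    then show ?thesis using has_integral_abs_inner_dir[OF p, of "a - b"] by (simp add: ab width_segment)
  qed
  have "finite {e. e edge_of K}"
    by (rule finite_subset[OF _ finite_polytope_faces[OF K(1)]]) (auto simp: edge_of_def)
  then have "((\<lambda>\<theta>. \<Sum>e | e edge_of K. width e (dir p \<theta>)) has_integral (\<Sum>e | e edge_of K. 2 * diameter e)) {-pi/2..pi/2}"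
    using edge by (intro has_integral_sum) auto
  then have "((\<lambda>\<theta>. 2 * width K (dir p \<theta>)) has_integral 2 * perimeter K) {-pi/2..pi/2}"
    using True by (simp add: sum_width_edges[OF K(1)] perimeter_def sum_distrib_left)
  from has_integral_mult_right[OF this, of "1/2"] show ?thesis by simp
next
  case False
  moreover have "aff_dim K \<le> 2" using aff_dim_le_DIM[of K] by simp
  ultimately have "aff_dim K \<le> 1" by linarith
  then obtain a b where ab: "K = closed_segment a b" using flat_polytope_segment K by metis
  show ?thesis using has_integral_abs_inner_dir[OF p, of "a - b"]
    by (simp add: ab width_segment perimeter_closed_segment dist_norm)
qed

section \<open>Reflected random walks\<close>

text \<open>Lindley's recursion for the walk reflected at \<open>0\<close>. Its value at time \<open>n\<close> is the maximum over \<open>k \<le> n\<close> of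
\<open>X\<^bsub>k+1\<^esub> + \<dots> + X\<^bsub>n\<^esub>\<close>; the recursive form exhibits it as a function of \<open>X\<^bsub>n\<^esub>\<close> and of
an independent variable. The index of the first step is \<open>1\<close>.\<close>
fun lindley :: "(nat \<Rightarrow> real) \<Rightarrow> nat \<Rightarrow> real" where
  "lindley X 0 = 0"
| "lindley X (Suc n) = max 0 (lindley X n + X (Suc n))"

lemma lindley_nonneg: "0 \<le> lindley X n"
  by (induction n) auto

lemma lindley_cong: "(\<And>i. i \<in> {1..n} \<Longrightarrow> X i = Y i) \<Longrightarrow> lindley X n = lindley Y n"
  by (induction n) auto

lemma sum_le_lindley: "k \<le> n \<Longrightarrow> (\<Sum>i\<in>{k<..n}. X i) \<le> lindley X n"
proof (induction n)
  case (Suc n)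
  show ?case
  proof (cases "k = Suc n")
    case False
    then have k: "k \<le> n" using Suc.prems by simp
    then have "{k<..Suc n} = insert (Suc n) {k<..n}" by auto
    then have "(\<Sum>i\<in>{k<..Suc n}. X i) = (\<Sum>i\<in>{k<..n}. X i) + X (Suc n)" by simp
    then show ?thesis using Suc.IH[OF k] by simp
  qed simp
qed simp

lemma lindley_add_le: "lindley (\<lambda>i. X i + Y i) n \<le> lindley X n + lindley Y n"
  by (induction n) auto

lemma measurable_lindley [measurable (raw)]:
  assumes "\<And>i. i \<in> {1..n} \<Longrightarrow> (\<lambda>\<omega>. X \<omega> i) \<in> borel_measurable M"
  shows "(\<lambda>\<omega>. lindley (X \<omega>) n) \<in> borel_measurable M"
  using assms
proof (induction n)
  case (Suc n)
  then have [measurable]: "(\<lambda>\<omega>. lindley (X \<omega>) n) \<in> borel_measurable M"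
    "(\<lambda>\<omega>. X \<omega> (Suc n)) \<in> borel_measurable M" by auto
  show ?case unfolding lindley.simps by measurable
qed simp

context prob_space
begin

lemma indep_vars_reindex:
  assumes inj: "inj_on f I" and indep: "indep_vars (\<lambda>_. N) X (f ` I)"
  shows "indep_vars (\<lambda>_. N) (\<lambda>i. X (f i)) I"
  unfolding indep_vars_def2 indep_sets_def
proof (intro conjI allI impI ballI)
  show "random_variable N (X (f i))" if "i \<in> I" for i
    using indep that by (auto simp: indep_vars_def2)
  show "{X (f i) -` A \<inter> space M |A. A \<in> sets N} \<subseteq> events" if "i \<in> I" for i
    using indep that by (auto simp: indep_vars_def2 indep_sets_def)
  fix J A assume J: "J \<subseteq> I" "J \<noteq> {}" "finite J"
    and A: "A \<in> (\<Pi> i\<in>J. {X (f i) -` A \<inter> space M |A. A \<in> sets N})"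
  have injJ: "inj_on f J" using inj J(1) by (rule inj_on_subset)
  define A' where "A' = A \<circ> the_inv_into J f"
  have A': "A' (f j) = A j" if "j \<in> J" for j
    using that injJ by (simp add: A'_def the_inv_into_f_f)
  have "A' \<in> (\<Pi> i\<in>f ` J. {X i -` A \<inter> space M |A. A \<in> sets N})"
    using A A' by (auto simp: Pi_iff)
  moreover have "f ` J \<subseteq> f ` I" "f ` J \<noteq> {}" "finite (f ` J)" using J by auto
  ultimately have "prob (\<Inter>j\<in>f ` J. A' j) = (\<Prod>j\<in>f ` J. prob (A' j))"
    using indep unfolding indep_vars_def2 indep_sets_def by blast
  then show "prob (\<Inter>j\<in>J. A j) = (\<Prod>j\<in>J. prob (A j))"
    using A' by (simp add: prod.reindex[OF injJ])
qed

text \<open>The reflected walk at time \<open>n\<close> is a function of the steps \<open>1, \<dots>, n\<close> only.\<close>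
lemma indep_var_lindley:
  assumes "indep_vars (\<lambda>_. borel) X {1..Suc n}"
  shows "indep_var borel (\<lambda>\<omega>. lindley (\<lambda>i. X i \<omega>) n) borel (X (Suc n))"
proof -
  have "indep_var
    borel ((\<lambda>f. lindley f n) \<circ> (\<lambda>\<omega>. restrict (\<lambda>i. X i \<omega>) {1..n}))
    borel ((\<lambda>f. f (Suc n)) \<circ> (\<lambda>\<omega>. restrict (\<lambda>i. X i \<omega>) {Suc n}))"
    by (intro indep_var_compose[OF indep_var_restrict[OF assms]] measurable_lindley) auto
  also have "(\<lambda>f. lindley f n) \<circ> (\<lambda>\<omega>. restrict (\<lambda>i. X i \<omega>) {1..n}) = (\<lambda>\<omega>. lindley (\<lambda>i. X i \<omega>) n)"
    by (auto simp: fun_eq_iff intro: lindley_cong)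
  also have "(\<lambda>f. f (Suc n)) \<circ> (\<lambda>\<omega>. restrict (\<lambda>i. X i \<omega>) {Suc n}) = X (Suc n)"
    by auto
  finally show ?thesis .
qed

lemma indep_vars_measurable:
  "indep_vars (\<lambda>_. borel) X I \<Longrightarrow> i \<in> I \<Longrightarrow> X i \<in> borel_measurable M"
  by (auto simp: indep_vars_def2)

text \<open>Since \<open>(max 0 (R + X))\<^sup>2 \<le> R\<^sup>2 + 2 R X + X\<^sup>2\<close> and \<open>E (R X) = E R E X \<le> 0\<close>, each step adds at
most \<open>E X\<^sup>2\<close>. This takes the place of a maximal inequality.\<close>
lemma lindley_second_moment:
  assumes indep: "indep_vars (\<lambda>_. borel) X {1..n}"
    and sq: "\<And>i. i \<in> {1..n} \<Longrightarrow> integrable M (\<lambda>\<omega>. (X i \<omega>)\<^sup>2)"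
    and drift: "\<And>i. i \<in> {1..n} \<Longrightarrow> expectation (X i) \<le> 0"
  shows "integrable M (\<lambda>\<omega>. (lindley (\<lambda>i. X i \<omega>) n)\<^sup>2) \<and>
    expectation (\<lambda>\<omega>. (lindley (\<lambda>i. X i \<omega>) n)\<^sup>2) \<le> (\<Sum>i=1..n. expectation (\<lambda>\<omega>. (X i \<omega>)\<^sup>2))"
  using assms
proof (induction n)
  case (Suc n)
  let ?R = "\<lambda>n \<omega>. lindley (\<lambda>i. X i \<omega>) n" and ?X = "X (Suc n)"
  have "indep_vars (\<lambda>_. borel) X {1..n}" by (rule indep_vars_subset[OF Suc.prems(1)]) auto
  then have IH: "integrable M (\<lambda>\<omega>. (?R n \<omega>)\<^sup>2)"
    "expectation (\<lambda>\<omega>. (?R n \<omega>)\<^sup>2) \<le> (\<Sum>i=1..n. expectation (\<lambda>\<omega>. (X i \<omega>)\<^sup>2))"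
    using Suc by auto
  have X: "X i \<in> borel_measurable M" if "i \<in> {1..Suc n}" for i
    using Suc.prems(1) that by (rule indep_vars_measurable)
  have Xm [measurable]: "?X \<in> borel_measurable M" by (rule X) auto
  have Rm [measurable]: "?R n \<in> borel_measurable M" "?R (Suc n) \<in> borel_measurable M"
    by (rule measurable_lindley; auto intro: X)+
  have sqX: "integrable M (\<lambda>\<omega>. (?X \<omega>)\<^sup>2)" and drX: "expectation ?X \<le> 0" using Suc.prems by auto
  have int: "integrable M ?X" "integrable M (?R n)"
    using square_integrable_imp_integrable[OF Xm sqX] square_integrable_imp_integrable[OF Rm(1) IH(1)] by auto
  note ind = indep_var_lindley[OF Suc.prems(1)]
  have prod: "integrable M (\<lambda>\<omega>. ?R n \<omega> * ?X \<omega>)"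
    "expectation (\<lambda>\<omega>. ?R n \<omega> * ?X \<omega>) = expectation (?R n) * expectation ?X"
    using indep_var_integrable[OF ind int(2,1)] indep_var_lebesgue_integral[OF ind int(2,1)] by auto
  have "0 \<le> expectation (?R n)" by (intro integral_nonneg_AE) (simp add: lindley_nonneg)
  then have cross: "expectation (\<lambda>\<omega>. ?R n \<omega> * ?X \<omega>) \<le> 0"
    using drX prod(2) by (simp add: mult_nonneg_nonpos)
  let ?S = "\<lambda>\<omega>. (?R n \<omega>)\<^sup>2 + 2 * (?R n \<omega> * ?X \<omega>) + (?X \<omega>)\<^sup>2"
  have S: "integrable M ?S" using IH(1) prod(1) sqX by auto
  have le: "(?R (Suc n) \<omega>)\<^sup>2 \<le> ?S \<omega>" for \<omega>
  proof -
    have "(max 0 (a + b))\<^sup>2 \<le> (a + b)\<^sup>2" for a b :: real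
      by (auto simp: max_def)
    from this[of "?R n \<omega>" "?X \<omega>"] show ?thesis by (simp add: power2_sum)
  qed
  have I: "integrable M (\<lambda>\<omega>. (?R (Suc n) \<omega>)\<^sup>2)"
    by (rule Bochner_Integration.integrable_bound[OF S])
      (auto simp del: lindley.simps intro!: order_trans[OF le abs_ge_self])
  have "expectation (\<lambda>\<omega>. (?R (Suc n) \<omega>)\<^sup>2) \<le> expectation ?S"
    using I S le by (rule integral_mono)
  also have "\<dots> = expectation (\<lambda>\<omega>. (?R n \<omega>)\<^sup>2) + 2 * expectation (\<lambda>\<omega>. ?R n \<omega> * ?X \<omega>) + expectation (\<lambda>\<omega>. (?X \<omega>)\<^sup>2)"
    using IH(1) prod(1) sqX by simp
  also have "\<dots> \<le> (\<Sum>i=1..Suc n. expectation (\<lambda>\<omega>. (X i \<omega>)\<^sup>2))"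
    using IH(2) cross by simp
  finally show ?case using I by simp
qed simp

text \<open>Since \<open>exp (l max 0 (R + X)) \<le> 1 + exp (l R) exp (l X)\<close>, the exponential moments satisfy
\<open>m' \<le> 1 + \<rho> m\<close>, and \<open>1 / (1 - \<rho>)\<close> is the fixed point of this recursion.\<close>
lemma lindley_exp_moment:
  assumes indep: "indep_vars (\<lambda>_. borel) X {1..n}" and l: "0 \<le> l" and \<rho>: "0 \<le> \<rho>" "\<rho> < 1"
    and int: "\<And>i. i \<in> {1..n} \<Longrightarrow> integrable M (\<lambda>\<omega>. exp (l * X i \<omega>))"
    and le: "\<And>i. i \<in> {1..n} \<Longrightarrow> expectation (\<lambda>\<omega>. exp (l * X i \<omega>)) \<le> \<rho>"
  shows "integrable M (\<lambda>\<omega>. exp (l * lindley (\<lambda>i. X i \<omega>) n)) \<and>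
    expectation (\<lambda>\<omega>. exp (l * lindley (\<lambda>i. X i \<omega>) n)) \<le> 1 / (1 - \<rho>)"
  using indep int le
proof (induction n)
  case 0
  then show ?case using \<rho> by (simp add: prob_space)
next
  case (Suc n)
  let ?R = "\<lambda>n \<omega>. lindley (\<lambda>i. X i \<omega>) n" and ?X = "X (Suc n)"
  have "indep_vars (\<lambda>_. borel) X {1..n}" by (rule indep_vars_subset[OF Suc.prems(1)]) auto
  then have IH: "integrable M (\<lambda>\<omega>. exp (l * ?R n \<omega>))"
    "expectation (\<lambda>\<omega>. exp (l * ?R n \<omega>)) \<le> 1 / (1 - \<rho>)"
    using Suc by auto
  have X: "X i \<in> borel_measurable M" if "i \<in> {1..Suc n}" for i
    using Suc.prems(1) that by (rule indep_vars_measurable)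
  have Rm [measurable]: "?R (Suc n) \<in> borel_measurable M"
    by (rule measurable_lindley; auto intro: X)+
  have eX: "integrable M (\<lambda>\<omega>. exp (l * ?X \<omega>))" "expectation (\<lambda>\<omega>. exp (l * ?X \<omega>)) \<le> \<rho>"
    using Suc.prems by auto
  have ind: "indep_var borel (\<lambda>\<omega>. exp (l * ?R n \<omega>)) borel (\<lambda>\<omega>. exp (l * ?X \<omega>))"
    using indep_var_compose[OF indep_var_lindley[OF Suc.prems(1)], of "\<lambda>x. exp (l * x)" borel "\<lambda>x. exp (l * x)" borel]
    by (simp add: comp_def)
  have prod: "integrable M (\<lambda>\<omega>. exp (l * ?R n \<omega>) * exp (l * ?X \<omega>))"
    "expectation (\<lambda>\<omega>. exp (l * ?R n \<omega>) * exp (l * ?X \<omega>)) = expectation (\<lambda>\<omega>. exp (l * ?R n \<omega>)) * expectation (\<lambda>\<omega>. exp (l * ?X \<omega>))"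
    using indep_var_integrable[OF ind IH(1) eX(1)] indep_var_lebesgue_integral[OF ind IH(1) eX(1)] by auto
  let ?S = "\<lambda>\<omega>. 1 + exp (l * ?R n \<omega>) * exp (l * ?X \<omega>)"
  have S: "integrable M ?S" using prod(1) by simp
  have le: "exp (l * ?R (Suc n) \<omega>) \<le> ?S \<omega>" for \<omega>
    by (auto simp: max_def distrib_left exp_add)
  have I: "integrable M (\<lambda>\<omega>. exp (l * ?R (Suc n) \<omega>))"
    by (rule Bochner_Integration.integrable_bound[OF S])
      (use le in \<open>auto simp del: lindley.simps intro: order_trans\<close>)
  have "expectation (\<lambda>\<omega>. exp (l * ?R (Suc n) \<omega>)) \<le> expectation ?S"
    using I S le by (rule integral_mono)
  also have "\<dots> = 1 + expectation (\<lambda>\<omega>. exp (l * ?R n \<omega>)) * expectation (\<lambda>\<omega>. exp (l * ?X \<omega>))"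
    using prod by (simp add: prob_space)
  also have "\<dots> \<le> 1 + 1 / (1 - \<rho>) * \<rho>"
    using IH(2) eX(2) \<rho> by (intro add_left_mono mult_mono) (auto intro!: integral_nonneg_AE)
  also have "\<dots> = 1 / (1 - \<rho>)" using \<rho> by (simp add: field_simps)
  finally show ?case using I by simp
qed

end

section \<open>Negative drift\<close>

lemma (in prob_space) same_distr_transfer:
  fixes X \<xi> :: "'a \<Rightarrow> 'b::topological_space" and f :: "'b \<Rightarrow> real"
  assumes [measurable]: "X \<in> borel_measurable M" "\<xi> \<in> borel_measurable M" "f \<in> borel_measurable borel"
    and d: "distr M borel X = distr M borel \<xi>"
  shows "expectation (\<lambda>\<omega>. f (X \<omega>)) = expectation (\<lambda>\<omega>. f (\<xi> \<omega>))"
    and "integrable M (\<lambda>\<omega>. f (X \<omega>)) \<longleftrightarrow> integrable M (\<lambda>\<omega>. f (\<xi> \<omega>))"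
proof -
  have "expectation (\<lambda>\<omega>. f (X \<omega>)) = (\<integral>x. f x \<partial>distr M borel X)" by (simp add: integral_distr)
  also have "\<dots> = expectation (\<lambda>\<omega>. f (\<xi> \<omega>))" by (simp add: d integral_distr)
  finally show "expectation (\<lambda>\<omega>. f (X \<omega>)) = expectation (\<lambda>\<omega>. f (\<xi> \<omega>))" .
  have "integrable M (\<lambda>\<omega>. f (X \<omega>)) \<longleftrightarrow> integrable (distr M borel X) f" by (simp add: integrable_distr_eq)
  also have "\<dots> \<longleftrightarrow> integrable M (\<lambda>\<omega>. f (\<xi> \<omega>))" by (simp add: d integrable_distr_eq)
  finally show "integrable M (\<lambda>\<omega>. f (X \<omega>)) \<longleftrightarrow> integrable M (\<lambda>\<omega>. f (\<xi> \<omega>))" .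
qed

lemma (in prob_space) truncation_tail:
  fixes \<xi> :: "'a \<Rightarrow> real"
  assumes [measurable]: "\<xi> \<in> borel_measurable M" and sq: "integrable M (\<lambda>\<omega>. (\<xi> \<omega>)\<^sup>2)" and "0 < \<epsilon>"
  obtains B :: real where "expectation (\<lambda>\<omega>. (max 0 (\<xi> \<omega> - B))\<^sup>2) \<le> \<epsilon>" "0 \<le> B"
proof -
  have "(\<lambda>k. expectation (\<lambda>\<omega>. (max 0 (\<xi> \<omega> - real k))\<^sup>2)) \<longlonglongrightarrow> expectation (\<lambda>\<omega>. 0)"
  proof (rule integral_dominated_convergence[OF _ _ sq])
    show "AE \<omega> in M. (\<lambda>k. (max 0 (\<xi> \<omega> - real k))\<^sup>2) \<longlonglongrightarrow> 0"
    proof (intro AE_I2 tendsto_eventually)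
      fix \<omega>
      have "eventually (\<lambda>k. \<xi> \<omega> \<le> real k) sequentially"
        using eventually_ge_at_top[of "nat \<lceil>\<xi> \<omega>\<rceil>"] by eventually_elim linarith
      then show "\<forall>\<^sub>F k in sequentially. (max 0 (\<xi> \<omega> - real k))\<^sup>2 = 0"
        by eventually_elim simp
    qed
    have "(max 0 (x - real k))\<^sup>2 \<le> x\<^sup>2" for x k
      by (cases "x \<le> real k") (auto simp: max_def intro!: power_mono)
    then show "AE \<omega> in M. norm ((max 0 (\<xi> \<omega> - real k))\<^sup>2) \<le> (\<xi> \<omega>)\<^sup>2" for k by simp
  qed auto
  then have "eventually (\<lambda>k. expectation (\<lambda>\<omega>. (max 0 (\<xi> \<omega> - real k))\<^sup>2) < \<epsilon>) sequentially"
    using order_tendstoD(2)[of _ 0 sequentially \<epsilon>] \<open>0 < \<epsilon>\<close> by simp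
  then obtain k where "expectation (\<lambda>\<omega>. (max 0 (\<xi> \<omega> - real k))\<^sup>2) < \<epsilon>"
    by (auto simp: eventually_sequentially)
  then show thesis using that[of "real k"] by simp
qed

lemma exp_le_quadratic:
  fixes x :: real
  assumes "x \<le> 1"
  shows "exp x \<le> 1 + x + x\<^sup>2"
proof (cases "0 \<le> x")
  case True
  then show ?thesis using assms by (rule exp_bound)
next
  case False
  have "1 - x \<le> exp (- x)" using exp_ge_add_one_self[of "- x"] by simp
  moreover have "1 - x > 0" using False by simp
  ultimately have "exp x \<le> 1 / (1 - x)" by (simp add: exp_minus field_simps)
  also have "\<dots> \<le> 1 + x + x\<^sup>2"
  proof -
    have "x ^ 3 \<le> 0" using False by (simp add: power_le_zero_eq)
    then have "1 \<le> (1 + x + x\<^sup>2) * (1 - x)" by (simp add: algebra_simps power2_eq_square power3_eq_cube)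
    then show ?thesis using False by (simp add: divide_le_eq)
  qed
  finally show ?thesis .
qed

lemma square_le_exp:
  fixes x :: real
  assumes "0 \<le> x"
  shows "x\<^sup>2 \<le> 4 * exp x"
proof -
  have "x / 2 \<le> exp (x / 2)" using exp_ge_add_one_self[of "x / 2"] by linarith
  then have "(x / 2)\<^sup>2 \<le> (exp (x / 2))\<^sup>2" using assms by (intro power_mono) auto
  also have "(exp (x / 2))\<^sup>2 = exp x" by (simp add: power2_eq_square flip: exp_add)
  finally show ?thesis by (simp add: power_divide)
qed

text \<open>For small \<open>l > 0\<close> the bound on \<open>\<eta>\<close> gives \<open>l \<eta> \<le> 1\<close>, hence
\<open>E exp (l \<eta>) \<le> 1 + l E \<eta> + l\<^sup>2 E \<eta>\<^sup>2\<close>, where the negative linear term dominates.\<close>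
lemma (in prob_space) exp_moment_less_1:
  fixes \<eta> :: "'a \<Rightarrow> real"
  assumes m [measurable]: "\<eta> \<in> borel_measurable M" and sq: "integrable M (\<lambda>\<omega>. (\<eta> \<omega>)\<^sup>2)"
    and drift: "expectation \<eta> < 0" and bound: "\<And>\<omega>. \<eta> \<omega> \<le> b"
  obtains l \<rho> where "0 < l" "0 \<le> \<rho>" "\<rho> < 1" "integrable M (\<lambda>\<omega>. exp (l * \<eta> \<omega>))"
    "expectation (\<lambda>\<omega>. exp (l * \<eta> \<omega>)) \<le> \<rho>"
proof -
  define m2 where "m2 = expectation (\<lambda>\<omega>. (\<eta> \<omega>)\<^sup>2)"
  define c where "c = - expectation \<eta>"
  \<comment> \<open>The two bounds make \<open>l b \<le> 1\<close> and \<open>l m2 < c\<close>; the added ones avoid division by zero.\<close>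
  define l where "l = min (1 / (\<bar>b\<bar> + 1)) (c / (2 * (m2 + 1)))"
  define \<rho> where "\<rho> = 1 - l * c + l\<^sup>2 * m2"
  have m2: "0 \<le> m2" unfolding m2_def by (intro integral_nonneg_AE) simp
  have c: "0 < c" using drift by (simp add: c_def)
  have l: "0 < l" "l \<le> 1 / (\<bar>b\<bar> + 1)" "l \<le> c / (2 * (m2 + 1))" using c m2 by (auto simp: l_def)
  have int: "integrable M \<eta>" by (rule square_integrable_imp_integrable[OF m sq])
  have l1: "l * \<eta> \<omega> \<le> 1" for \<omega>
  proof -
    have "l * \<eta> \<omega> \<le> l * (\<bar>b\<bar> + 1)" using l(1) bound[of \<omega>] by (intro mult_left_mono) auto
    also have "\<dots> \<le> 1" using l(2) by (simp add: pos_le_divide_eq)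
    finally show ?thesis .
  qed
  have e: "integrable M (\<lambda>\<omega>. exp (l * \<eta> \<omega>))"
    using l1 by (intro integrable_const_bound[where B = "exp 1"]) auto
  have "expectation (\<lambda>\<omega>. exp (l * \<eta> \<omega>)) \<le> expectation (\<lambda>\<omega>. 1 + l * \<eta> \<omega> + l\<^sup>2 * (\<eta> \<omega>)\<^sup>2)"
    using exp_le_quadratic[OF l1] by (intro integral_mono e) (use int sq in \<open>auto simp: power_mult_distrib\<close>)
  also have "\<dots> = \<rho>" using int sq by (simp add: \<rho>_def m2_def c_def prob_space)
  finally have le: "expectation (\<lambda>\<omega>. exp (l * \<eta> \<omega>)) \<le> \<rho>" .
  have "0 \<le> expectation (\<lambda>\<omega>. exp (l * \<eta> \<omega>))" by (intro integral_nonneg_AE) simp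
  then have "0 \<le> \<rho>" using le by linarith
  moreover have "\<rho> < 1"
  proof -
    have "l * m2 < c"
    proof -
      have "l * (2 * (m2 + 1)) \<le> c" using l(3) m2 by (simp add: pos_le_divide_eq)
      moreover have "0 \<le> l * m2" using l m2 by simp
      ultimately show ?thesis using l(1) by (simp add: algebra_simps)
    qed
    then have "l * (l * m2) < l * c" using l by simp
    then show ?thesis by (simp add: \<rho>_def power2_eq_square)
  qed
  ultimately show thesis using that l(1) e le by blast
qed

text \<open>With \<open>a = E max 0 (\<xi> - B)\<close>, the step is the sum of \<open>g \<xi> = min \<xi> B + a\<close>, which is bounded above by
\<open>B + a\<close> and has the same negative mean as \<open>\<xi>\<close>, and of the centred tail \<open>f \<xi> = max 0 (\<xi> - B) - a\<close>, whose
variance is small for large \<open>B\<close>. The reflected walk is subadditive in the steps, so the exponential moment bound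
for \<open>g\<close> yields the constant \<open>C\<close> and the second moment bound for \<open>f\<close> the term \<open>\<epsilon> n\<close>. The constant
depends on \<open>\<epsilon>\<close> and the law of \<open>\<xi>\<close>, but not on \<open>n\<close> or \<open>X\<close>, so the steps may be arranged in a different order for each \<open>n\<close>.\<close>
lemma (in prob_space) lindley_negative_drift:
  fixes \<xi> :: "'a \<Rightarrow> real"
  assumes m [measurable]: "\<xi> \<in> borel_measurable M" and sq: "integrable M (\<lambda>\<omega>. (\<xi> \<omega>)\<^sup>2)"
    and drift: "expectation \<xi> < 0" and \<epsilon>: "0 < \<epsilon>"
  obtains C where "0 \<le> C"
    "\<And>X n. indep_vars (\<lambda>_. borel) X {1..n} \<Longrightarrow>
      (\<And>i. i \<in> {1..n} \<Longrightarrow> distr M borel (X i) = distr M borel \<xi>) \<Longrightarrow>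
      expectation (\<lambda>\<omega>. (lindley (\<lambda>i. X i \<omega>) n)\<^sup>2) \<le> \<epsilon> * real n + C"
proof -
  obtain B where B: "expectation (\<lambda>\<omega>. (max 0 (\<xi> \<omega> - B))\<^sup>2) \<le> \<epsilon> / 2" "0 \<le> B"
    using truncation_tail[OF m sq, of "\<epsilon> / 2"] \<epsilon> by auto
  define a where "a = expectation (\<lambda>\<omega>. max 0 (\<xi> \<omega> - B))"
  define f where "f x = max 0 (x - B) - a" for x
  define g where "g x = min x B + a" for x
  have fg: "x = g x + f x" for x by (auto simp: f_def g_def min_def max_def)
  have [measurable]: "f \<in> borel_measurable borel" "g \<in> borel_measurable borel"
    unfolding f_def g_def by measurable
  have int: "integrable M \<xi>" by (rule square_integrable_imp_integrable[OF m sq])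
  have int_tail: "integrable M (\<lambda>\<omega>. max 0 (\<xi> \<omega> - B))" using int by auto
  have le: "(max 0 (x - B))\<^sup>2 \<le> x\<^sup>2" for x
    using B(2) by (cases "x \<le> B") (auto simp: max_def intro!: power_mono)
  have sq_tail: "integrable M (\<lambda>\<omega>. (max 0 (\<xi> \<omega> - B))\<^sup>2)"
    by (rule Bochner_Integration.integrable_bound[OF sq]) (use le in auto)
  have f_eq: "(f x)\<^sup>2 = (max 0 (x - B))\<^sup>2 - 2 * a * max 0 (x - B) + a\<^sup>2" for x
    by (simp add: f_def power2_diff algebra_simps)
  have fsq: "integrable M (\<lambda>\<omega>. (f (\<xi> \<omega>))\<^sup>2)" unfolding f_eq using sq_tail int_tail by auto
  have fint: "integrable M (\<lambda>\<omega>. f (\<xi> \<omega>))" unfolding f_def using int_tail by auto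
  have f0: "expectation (\<lambda>\<omega>. f (\<xi> \<omega>)) = 0" unfolding f_def using int_tail by (simp add: a_def prob_space)
  have "expectation (\<lambda>\<omega>. (f (\<xi> \<omega>))\<^sup>2) = expectation (\<lambda>\<omega>. (max 0 (\<xi> \<omega> - B))\<^sup>2) - a\<^sup>2"
    unfolding f_eq using sq_tail int_tail by (simp add: prob_space a_def power2_eq_square)
  then have f2: "expectation (\<lambda>\<omega>. (f (\<xi> \<omega>))\<^sup>2) \<le> \<epsilon> / 2" using B(1) zero_le_power2[of a] by linarith
  have g_eq: "g x = x - f x" for x using fg[of x] by simp
  have gint: "integrable M (\<lambda>\<omega>. g (\<xi> \<omega>))" unfolding g_eq using int fint by auto
  have g0: "expectation (\<lambda>\<omega>. g (\<xi> \<omega>)) < 0" unfolding g_eq using int fint f0 drift by simp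
  have gsq: "integrable M (\<lambda>\<omega>. (g (\<xi> \<omega>))\<^sup>2)"
  proof (rule Bochner_Integration.integrable_bound)
    show "integrable M (\<lambda>\<omega>. 2 * (\<xi> \<omega>)\<^sup>2 + 2 * (f (\<xi> \<omega>))\<^sup>2)" using sq fsq by auto
    have "(g x)\<^sup>2 \<le> 2 * x\<^sup>2 + 2 * (f x)\<^sup>2" for x
    proof -
      have "0 \<le> (x + f x)\<^sup>2" by simp
      then show ?thesis unfolding g_eq by (simp add: power2_diff power2_sum)
    qed
    then show "AE \<omega> in M. norm ((g (\<xi> \<omega>))\<^sup>2) \<le> norm (2 * (\<xi> \<omega>)\<^sup>2 + 2 * (f (\<xi> \<omega>))\<^sup>2)" by simp
  qed simp
  obtain l \<rho> where l: "0 < l" "0 \<le> \<rho>" "\<rho> < 1" "integrable M (\<lambda>\<omega>. exp (l * g (\<xi> \<omega>)))"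
    "expectation (\<lambda>\<omega>. exp (l * g (\<xi> \<omega>))) \<le> \<rho>"
    using exp_moment_less_1[OF _ gsq g0, of "B + a"] by (auto simp: g_def)
  define C where "C = 8 / (l\<^sup>2 * (1 - \<rho>))"
  show thesis
  proof (rule that[of C])
    show "0 \<le> C" using l by (simp add: C_def)
    fix X :: "nat \<Rightarrow> 'a \<Rightarrow> real" and n
    assume indep: "indep_vars (\<lambda>_. borel) X {1..n}"
      and dis: "\<And>i. i \<in> {1..n} \<Longrightarrow> distr M borel (X i) = distr M borel \<xi>"
    have X [measurable]: "X i \<in> borel_measurable M" if "i \<in> {1..n}" for i
      using indep that by (rule indep_vars_measurable)
    have tr: "expectation (\<lambda>\<omega>. h (X i \<omega>)) = expectation (\<lambda>\<omega>. h (\<xi> \<omega>))"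
      "integrable M (\<lambda>\<omega>. h (X i \<omega>)) \<longleftrightarrow> integrable M (\<lambda>\<omega>. h (\<xi> \<omega>))"
      if "i \<in> {1..n}" "h \<in> borel_measurable borel" for i and h :: "real \<Rightarrow> real"
      using same_distr_transfer[OF X m that(2) dis] that(1) by auto
    have "indep_vars (\<lambda>_. borel) (\<lambda>i \<omega>. f (X i \<omega>)) {1..n}"
      by (rule indep_vars_compose2[OF indep]) measurable
    then have F: "integrable M (\<lambda>\<omega>. (lindley (\<lambda>i. f (X i \<omega>)) n)\<^sup>2) \<and>
      expectation (\<lambda>\<omega>. (lindley (\<lambda>i. f (X i \<omega>)) n)\<^sup>2) \<le> (\<Sum>i=1..n. expectation (\<lambda>\<omega>. (f (X i \<omega>))\<^sup>2))"
    proof (rule lindley_second_moment)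
      fix i assume i: "i \<in> {1..n}"
      show "integrable M (\<lambda>\<omega>. (f (X i \<omega>))\<^sup>2)"
        using tr(2)[OF i, of "\<lambda>x. (f x)\<^sup>2"] fsq by simp
      show "expectation (\<lambda>\<omega>. f (X i \<omega>)) \<le> 0"
        using tr(1)[OF i, of f] f0 by simp
    qed
    also have "(\<Sum>i=1..n. expectation (\<lambda>\<omega>. (f (X i \<omega>))\<^sup>2)) = (\<Sum>i=1..n. expectation (\<lambda>\<omega>. (f (\<xi> \<omega>))\<^sup>2))"
      using tr(1)[of _ "\<lambda>x. (f x)\<^sup>2"] by (intro sum.cong) auto
    finally have F: "integrable M (\<lambda>\<omega>. (lindley (\<lambda>i. f (X i \<omega>)) n)\<^sup>2)"
      "expectation (\<lambda>\<omega>. (lindley (\<lambda>i. f (X i \<omega>)) n)\<^sup>2) \<le> real n * (\<epsilon> / 2)"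
      using mult_left_mono[OF f2, of "real n"] by auto
    have "indep_vars (\<lambda>_. borel) (\<lambda>i \<omega>. g (X i \<omega>)) {1..n}"
      by (rule indep_vars_compose2[OF indep]) measurable
    then have G: "integrable M (\<lambda>\<omega>. exp (l * lindley (\<lambda>i. g (X i \<omega>)) n)) \<and>
      expectation (\<lambda>\<omega>. exp (l * lindley (\<lambda>i. g (X i \<omega>)) n)) \<le> 1 / (1 - \<rho>)"
    proof (rule lindley_exp_moment)
      fix i assume i: "i \<in> {1..n}"
      show "integrable M (\<lambda>\<omega>. exp (l * g (X i \<omega>)))"
        using tr(2)[OF i, of "\<lambda>x. exp (l * g x)"] l by simp
      show "expectation (\<lambda>\<omega>. exp (l * g (X i \<omega>))) \<le> \<rho>"
        using tr(1)[OF i, of "\<lambda>x. exp (l * g x)"] l by simp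
    qed (use l in auto)
    let ?L = "\<lambda>h \<omega>. lindley (\<lambda>i. h (X i \<omega>)) n"
    have "(lindley (\<lambda>i. X i \<omega>) n)\<^sup>2 \<le> 2 * (?L f \<omega>)\<^sup>2 + 8 / l\<^sup>2 * exp (l * ?L g \<omega>)" for \<omega>
    proof -
      have "lindley (\<lambda>i. X i \<omega>) n \<le> ?L g \<omega> + ?L f \<omega>"
        using lindley_add_le[of "\<lambda>i. g (X i \<omega>)" "\<lambda>i. f (X i \<omega>)" n] by (simp flip: fg)
      then have "(lindley (\<lambda>i. X i \<omega>) n)\<^sup>2 \<le> (?L g \<omega> + ?L f \<omega>)\<^sup>2"
        by (intro power_mono lindley_nonneg)
      also have "\<dots> \<le> 2 * (?L f \<omega>)\<^sup>2 + 2 * (?L g \<omega>)\<^sup>2"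
        using zero_le_power2[of "?L g \<omega> - ?L f \<omega>"] by (simp add: power2_diff power2_sum)
      also have "(?L g \<omega>)\<^sup>2 \<le> 4 * exp (l * ?L g \<omega>) / l\<^sup>2"
        using square_le_exp[of "l * ?L g \<omega>"] l lindley_nonneg[of "\<lambda>i. g (X i \<omega>)" n]
        by (simp add: power_mult_distrib pos_le_divide_eq mult.commute)
      finally show ?thesis by simp
    qed
    then have "expectation (\<lambda>\<omega>. (lindley (\<lambda>i. X i \<omega>) n)\<^sup>2) \<le>
      expectation (\<lambda>\<omega>. 2 * (?L f \<omega>)\<^sup>2 + 8 / l\<^sup>2 * exp (l * ?L g \<omega>))"
      using F(1) G by (intro integral_mono_AE') auto
    also have "\<dots> = 2 * expectation (\<lambda>\<omega>. (?L f \<omega>)\<^sup>2) + 8 / l\<^sup>2 * expectation (\<lambda>\<omega>. exp (l * ?L g \<omega>))"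
      using F G by simp
    also have "\<dots> \<le> 2 * (real n * (\<epsilon> / 2)) + 8 / l\<^sup>2 * (1 / (1 - \<rho>))"
      using F G by (intro add_mono mult_left_mono) auto
    also have "\<dots> = \<epsilon> * real n + C" by (simp add: C_def)
    finally show "expectation (\<lambda>\<omega>. (lindley (\<lambda>i. X i \<omega>) n)\<^sup>2) \<le> \<epsilon> * real n + C" .
  qed
qed

section \<open>The perimeter excess of a walk as an integral of gaps\<close>

text \<open>The density of the perimeter excess in direction \<open>u\<close>.\<close>
definition gap :: "(nat \<Rightarrow> 'a \<Rightarrow> real^2) \<Rightarrow> nat \<Rightarrow> real^2 \<Rightarrow> 'a \<Rightarrow> real" where
  "gap Z n u \<omega> = width (convex hull ((\<lambda>k. walk Z k \<omega>) ` {0..n})) u - walk Z n \<omega> \<bullet> u"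

lemma gap_eq:
  "gap Z n u \<omega> = Max ((\<lambda>k. walk Z k \<omega> \<bullet> u) ` {0..n}) - Min ((\<lambda>k. walk Z k \<omega> \<bullet> u) ` {0..n}) - walk Z n \<omega> \<bullet> u"
  by (simp add: gap_def width_hull image_image)

lemma gap_nonneg: "0 \<le> gap Z n u \<omega>"
proof -
  have "walk Z n \<omega> \<bullet> u \<le> Max ((\<lambda>k. walk Z k \<omega> \<bullet> u) ` {0..n})" by (intro Max_ge) auto
  moreover have "Min ((\<lambda>k. walk Z k \<omega> \<bullet> u) ` {0..n}) \<le> walk Z 0 \<omega> \<bullet> u" by (intro Min_le) auto
  moreover have "walk Z 0 \<omega> \<bullet> u = 0" by (simp add: walk_def)
  ultimately show ?thesis unfolding gap_eq by linarith
qed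

text \<open>The gap consists of the largest value of \<open>S\<^sub>k \<bullet> u - S\<^sub>n \<bullet> u\<close>, which is a sum of the last \<open>n - k\<close> negated steps,
and of the largest value of \<open>- S\<^sub>k \<bullet> u\<close>, which is such a sum once the \<open>n\<close> steps are put in reverse order.\<close>
lemma gap_le_lindley:
  "gap Z n u \<omega> \<le> lindley (\<lambda>i. - (Z i \<omega> \<bullet> u)) n + lindley (\<lambda>i. - (Z (n + 1 - i) \<omega> \<bullet> u)) n"
proof -
  let ?f = "\<lambda>k. walk Z k \<omega> \<bullet> u"
  have "Max (?f ` {0..n}) \<in> ?f ` {0..n}" "Min (?f ` {0..n}) \<in> ?f ` {0..n}"
    by (intro Max_in Min_in; simp)+
  then obtain a b where "a \<in> {0..n}" and a: "Max (?f ` {0..n}) = ?f a"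
    and "b \<in> {0..n}" and b: "Min (?f ` {0..n}) = ?f b"
    by (elim imageE)
  then have ab: "a \<le> n" "b \<le> n" by auto
  have f: "?f k = (\<Sum>i=1..k. Z i \<omega> \<bullet> u)" for k by (simp add: walk_def inner_sum_left)
  have "{1..n} = {1..a} \<union> {a<..n}" "{1..a} \<inter> {a<..n} = {}" using ab by auto
  then have "?f n = ?f a + (\<Sum>i\<in>{a<..n}. Z i \<omega> \<bullet> u)"
    unfolding f by (simp add: sum.union_disjoint)
  then have "?f a - ?f n = (\<Sum>i\<in>{a<..n}. - (Z i \<omega> \<bullet> u))" by (simp add: sum_negf)
  also have "\<dots> \<le> lindley (\<lambda>i. - (Z i \<omega> \<bullet> u)) n" using ab(1) by (rule sum_le_lindley)
  finally have A: "?f a - ?f n \<le> lindley (\<lambda>i. - (Z i \<omega> \<bullet> u)) n" .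
  have "- ?f b = (\<Sum>i=1..b. - (Z i \<omega> \<bullet> u))" by (simp add: f sum_negf)
  also have "\<dots> = (\<Sum>i\<in>{n-b<..n}. - (Z (n + 1 - i) \<omega> \<bullet> u))"
    by (rule sum.reindex_bij_witness[where i = "\<lambda>i. n + 1 - i" and j = "\<lambda>i. n + 1 - i"]) (use ab in auto)
  also have "\<dots> \<le> lindley (\<lambda>i. - (Z (n + 1 - i) \<omega> \<bullet> u)) n" by (rule sum_le_lindley) simp
  finally show ?thesis using A unfolding gap_eq a b by linarith
qed

lemma hull_perimeter_excess:
  assumes "norm p = 1"
  shows "((\<lambda>\<theta>. gap Z n (dir p \<theta>) \<omega>) has_integral hull_perimeter Z n \<omega> - 2 * (walk Z n \<omega> \<bullet> p)) {-pi/2..pi/2}"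
  unfolding gap_def hull_perimeter_def
  by (intro has_integral_diff Cauchy_perimeter has_integral_inner_dir assms)
    (auto intro: polytope_convex_hull)

section \<open>Second moment of the gap in a fixed direction\<close>

locale planar_iid = prob_space M for M :: "'a measure" +
  fixes Z :: "nat \<Rightarrow> 'a \<Rightarrow> real^2"
  assumes indep: "indep_vars (\<lambda>_. borel) Z UNIV"
    and same_distr: "\<And>k. distr M borel (Z k) = distr M borel (Z 0)"
    and square_integrable: "integrable M (\<lambda>\<omega>. (norm (Z 0 \<omega>))\<^sup>2)"
begin

lemma Z_measurable [measurable]: "Z k \<in> borel_measurable M"
  using indep by (auto simp: indep_vars_def2)

lemma walk_measurable [measurable]: "walk Z k \<in> borel_measurable M"
  unfolding walk_def by measurable

lemma Z_integrable: "integrable M (Z 0)"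
  by (rule integrable_norm_cancel[OF square_integrable_imp_integrable[OF _ square_integrable]]) auto

lemma drift_inner: "expectation (\<lambda>\<omega>. - (Z 0 \<omega> \<bullet> u)) = - (expectation (Z 0) \<bullet> u)"
  using Z_integrable by (simp add: integral_inner_left)

lemma inner_second_moment:
  assumes "norm u = 1"
  shows "integrable M (\<lambda>\<omega>. (- (Z 0 \<omega> \<bullet> u))\<^sup>2)"
    and "expectation (\<lambda>\<omega>. (- (Z 0 \<omega> \<bullet> u))\<^sup>2) \<le> expectation (\<lambda>\<omega>. (norm (Z 0 \<omega>))\<^sup>2)"
proof -
  have le: "(- (x \<bullet> u))\<^sup>2 \<le> (norm x)\<^sup>2" for x
    using power_mono[OF Cauchy_Schwarz_ineq2[of x u], of 2] assms by simp
  show *: "integrable M (\<lambda>\<omega>. (- (Z 0 \<omega> \<bullet> u))\<^sup>2)"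
    by (rule Bochner_Integration.integrable_bound[OF square_integrable]) (use le in auto)
  show "expectation (\<lambda>\<omega>. (- (Z 0 \<omega> \<bullet> u))\<^sup>2) \<le> expectation (\<lambda>\<omega>. (norm (Z 0 \<omega>))\<^sup>2)"
    using * square_integrable le by (rule integral_mono)
qed

lemma indep_projected_steps:
  assumes "inj_on f {1..n}"
  shows "indep_vars (\<lambda>_. borel) (\<lambda>i \<omega>. - (Z (f i) \<omega> \<bullet> u)) {1..n}"
proof -
  have "indep_vars (\<lambda>_. borel) Z (f ` {1..n})" by (rule indep_vars_subset[OF indep]) simp
  then have "indep_vars (\<lambda>_. borel) (\<lambda>i. Z (f i)) {1..n}" by (rule indep_vars_reindex[OF assms])
  then show ?thesis by (rule indep_vars_compose2) measurable
qed

lemma distr_projected_step: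
  "distr M borel (\<lambda>\<omega>. - (Z k \<omega> \<bullet> u)) = distr M borel (\<lambda>\<omega>. - (Z 0 \<omega> \<bullet> u))"
proof -
  have "distr M borel (\<lambda>\<omega>. - (Z j \<omega> \<bullet> u)) = distr (distr M borel (Z j)) borel (\<lambda>x. - (x \<bullet> u))" for j
    by (subst distr_distr) (auto simp: comp_def)
  then show ?thesis by (simp add: same_distr[of k])
qed

text \<open>The injection \<open>f\<close> allows the steps to be taken in their own order or in reverse order.\<close>
lemma projected_lindley_second_moment:
  assumes f: "inj_on f {1..n}" and u: "norm u = 1" "0 \<le> expectation (Z 0) \<bullet> u"
  shows "integrable M (\<lambda>\<omega>. (lindley (\<lambda>i. - (Z (f i) \<omega> \<bullet> u)) n)\<^sup>2)"
    and "expectation (\<lambda>\<omega>. (lindley (\<lambda>i. - (Z (f i) \<omega> \<bullet> u)) n)\<^sup>2) \<le> real n * expectation (\<lambda>\<omega>. (norm (Z 0 \<omega>))\<^sup>2)"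
proof -
  note tr = same_distr_transfer[OF _ _ _ distr_projected_step, of _ u]
  have e: "expectation (\<lambda>\<omega>. (- (Z k \<omega> \<bullet> u))\<^sup>2) = expectation (\<lambda>\<omega>. (- (Z 0 \<omega> \<bullet> u))\<^sup>2)" for k
    by (rule tr(1)[of _ "\<lambda>x. x\<^sup>2"]) measurable
  have "integrable M (\<lambda>\<omega>. (lindley (\<lambda>i. - (Z (f i) \<omega> \<bullet> u)) n)\<^sup>2) \<and>
    expectation (\<lambda>\<omega>. (lindley (\<lambda>i. - (Z (f i) \<omega> \<bullet> u)) n)\<^sup>2) \<le> (\<Sum>i=1..n. expectation (\<lambda>\<omega>. (- (Z (f i) \<omega> \<bullet> u))\<^sup>2))"
  proof (rule lindley_second_moment[OF indep_projected_steps[OF f]])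
    fix i
    show "integrable M (\<lambda>\<omega>. (- (Z (f i) \<omega> \<bullet> u))\<^sup>2)"
      by (subst tr(2)[of _ "\<lambda>x. x\<^sup>2"]; (rule inner_second_moment[OF u(1)])?) measurable
    have "expectation (\<lambda>\<omega>. - (Z (f i) \<omega> \<bullet> u)) = expectation (\<lambda>\<omega>. - (Z 0 \<omega> \<bullet> u))"
      by (rule tr(1)[of _ "\<lambda>x. x"]) measurable
    then show "expectation (\<lambda>\<omega>. - (Z (f i) \<omega> \<bullet> u)) \<le> 0" unfolding drift_inner using u(2) by simp
  qed
  moreover have "(\<Sum>i=1..n. expectation (\<lambda>\<omega>. (- (Z (f i) \<omega> \<bullet> u))\<^sup>2)) \<le> real n * expectation (\<lambda>\<omega>. (norm (Z 0 \<omega>))\<^sup>2)"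
  proof -
    have "(\<Sum>i=1..n. expectation (\<lambda>\<omega>. (- (Z (f i) \<omega> \<bullet> u))\<^sup>2)) = (\<Sum>i=1..n. expectation (\<lambda>\<omega>. (- (Z 0 \<omega> \<bullet> u))\<^sup>2))"
      by (intro sum.cong refl e)
    then show ?thesis using mult_left_mono[OF inner_second_moment(2)[OF u(1)], of "real n"] by simp
  qed
  ultimately show "integrable M (\<lambda>\<omega>. (lindley (\<lambda>i. - (Z (f i) \<omega> \<bullet> u)) n)\<^sup>2)"
    "expectation (\<lambda>\<omega>. (lindley (\<lambda>i. - (Z (f i) \<omega> \<bullet> u)) n)\<^sup>2) \<le> real n * expectation (\<lambda>\<omega>. (norm (Z 0 \<omega>))\<^sup>2)"
    by auto
qed

lemma inj_on_reverse: "inj_on (\<lambda>i. n + 1 - i) {1..n::nat}"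
  by (rule inj_onI) auto

lemma gap_measurable [measurable]: "gap Z n u \<in> borel_measurable M"
  unfolding gap_eq[abs_def] by measurable

lemma gap_second_moment_split:
  assumes u: "norm u = 1" "0 \<le> expectation (Z 0) \<bullet> u"
    and A: "expectation (\<lambda>\<omega>. (lindley (\<lambda>i. - (Z i \<omega> \<bullet> u)) n)\<^sup>2) \<le> c"
    and B: "expectation (\<lambda>\<omega>. (lindley (\<lambda>i. - (Z (n + 1 - i) \<omega> \<bullet> u)) n)\<^sup>2) \<le> c"
  shows "integrable M (\<lambda>\<omega>. (gap Z n u \<omega>)\<^sup>2)" "expectation (\<lambda>\<omega>. (gap Z n u \<omega>)\<^sup>2) \<le> 4 * c"
proof -
  let ?A = "\<lambda>\<omega>. lindley (\<lambda>i. - (Z i \<omega> \<bullet> u)) n" and ?B = "\<lambda>\<omega>. lindley (\<lambda>i. - (Z (n + 1 - i) \<omega> \<bullet> u)) n"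
  have int: "integrable M (\<lambda>\<omega>. (?A \<omega>)\<^sup>2)" "integrable M (\<lambda>\<omega>. (?B \<omega>)\<^sup>2)"
    using projected_lindley_second_moment(1)[of "\<lambda>i. i", OF _ u]
      projected_lindley_second_moment(1)[OF inj_on_reverse u] by auto
  have le: "(gap Z n u \<omega>)\<^sup>2 \<le> 2 * (?A \<omega>)\<^sup>2 + 2 * (?B \<omega>)\<^sup>2" for \<omega>
  proof -
    have "(gap Z n u \<omega>)\<^sup>2 \<le> (?A \<omega> + ?B \<omega>)\<^sup>2"
      by (intro power_mono gap_le_lindley gap_nonneg)
    also have "\<dots> \<le> 2 * (?A \<omega>)\<^sup>2 + 2 * (?B \<omega>)\<^sup>2"
      using zero_le_power2[of "?A \<omega> - ?B \<omega>"] unfolding power2_diff power2_sum by linarith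
    finally show ?thesis .
  qed
  have int2: "integrable M (\<lambda>\<omega>. 2 * (?A \<omega>)\<^sup>2 + 2 * (?B \<omega>)\<^sup>2)" using int by auto
  show I: "integrable M (\<lambda>\<omega>. (gap Z n u \<omega>)\<^sup>2)"
    by (rule Bochner_Integration.integrable_bound[OF int2]) (use le in auto)
  have "expectation (\<lambda>\<omega>. (gap Z n u \<omega>)\<^sup>2) \<le> expectation (\<lambda>\<omega>. 2 * (?A \<omega>)\<^sup>2 + 2 * (?B \<omega>)\<^sup>2)"
    using I int2 le by (rule integral_mono)
  also have "\<dots> \<le> 4 * c" using A B int by simp
  finally show "expectation (\<lambda>\<omega>. (gap Z n u \<omega>)\<^sup>2) \<le> 4 * c" .
qed

lemma gap_second_moment:
  assumes u: "norm u = 1" "0 \<le> expectation (Z 0) \<bullet> u"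
  shows "integrable M (\<lambda>\<omega>. (gap Z n u \<omega>)\<^sup>2)"
    and "expectation (\<lambda>\<omega>. (gap Z n u \<omega>)\<^sup>2) \<le> 4 * (real n * expectation (\<lambda>\<omega>. (norm (Z 0 \<omega>))\<^sup>2))"
  using gap_second_moment_split[OF u projected_lindley_second_moment(2)[of "\<lambda>i. i", OF _ u]
      projected_lindley_second_moment(2)[OF inj_on_reverse u]] by auto

lemma gap_second_moment_tendsto:
  assumes u: "norm u = 1" "0 < expectation (Z 0) \<bullet> u"
  shows "(\<lambda>n. expectation (\<lambda>\<omega>. (gap Z n u \<omega>)\<^sup>2) / real n) \<longlonglongrightarrow> 0"
proof (rule LIMSEQ_I)
  fix r :: real assume r: "0 < r"
  obtain C where C: "0 \<le> C" "\<And>X n. indep_vars (\<lambda>_. borel) X {1..n} \<Longrightarrow>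
      (\<And>i. i \<in> {1..n} \<Longrightarrow> distr M borel (X i) = distr M borel (\<lambda>\<omega>. - (Z 0 \<omega> \<bullet> u))) \<Longrightarrow>
      expectation (\<lambda>\<omega>. (lindley (\<lambda>i. X i \<omega>) n)\<^sup>2) \<le> (r / 8) * real n + C"
  proof (rule lindley_negative_drift)
    show "expectation (\<lambda>\<omega>. - (Z 0 \<omega> \<bullet> u)) < 0" unfolding drift_inner using u(2) by simp
    show "integrable M (\<lambda>\<omega>. (- (Z 0 \<omega> \<bullet> u))\<^sup>2)" by (rule inner_second_moment[OF u(1)])
    show "0 < r / 8" using r by simp
  qed auto
  have le: "expectation (\<lambda>\<omega>. (gap Z n u \<omega>)\<^sup>2) \<le> 4 * (r / 8 * real n + C)" for n
  proof (rule gap_second_moment_split(2)[OF u(1) less_imp_le[OF u(2)]])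
    show "expectation (\<lambda>\<omega>. (lindley (\<lambda>i. - (Z i \<omega> \<bullet> u)) n)\<^sup>2) \<le> r / 8 * real n + C"
      by (rule C(2)[OF indep_projected_steps distr_projected_step]) simp
    show "expectation (\<lambda>\<omega>. (lindley (\<lambda>i. - (Z (n + 1 - i) \<omega> \<bullet> u)) n)\<^sup>2) \<le> r / 8 * real n + C"
      by (rule C(2)[OF indep_projected_steps[OF inj_on_reverse] distr_projected_step])
  qed
  obtain N :: nat where N: "8 * C / r < real N" using reals_Archimedean2 by blast
  show "\<exists>no. \<forall>n\<ge>no. norm (expectation (\<lambda>\<omega>. (gap Z n u \<omega>)\<^sup>2) / real n - 0) < r"
  proof (intro exI allI impI)
    fix n assume "Suc N \<le> n"
    then have n: "8 * C / r < real n" "0 < real n" using N by auto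
    then have "8 * C < r * real n" using r by (simp add: pos_divide_less_eq mult.commute)
    then have "expectation (\<lambda>\<omega>. (gap Z n u \<omega>)\<^sup>2) < r * real n" using le[of n] by simp
    moreover have "0 \<le> expectation (\<lambda>\<omega>. (gap Z n u \<omega>)\<^sup>2)" by (intro integral_nonneg_AE) simp
    ultimately show "norm (expectation (\<lambda>\<omega>. (gap Z n u \<omega>)\<^sup>2) / real n - 0) < r"
      using n by (simp add: pos_divide_less_eq)
  qed
qed

end

section \<open>Averaging over directions\<close>

lemma dir_measurable [measurable]: "dir p \<in> borel_measurable borel"
  unfolding dir_def[abs_def] by measurable

context planar_iid
begin

text \<open>Joint measurability is needed to exchange the integrals over directions and outcomes.\<close>
lemma gap_dir_measurable [measurable]:
  "(\<lambda>(\<theta>, \<omega>). gap Z n (dir p \<theta>) \<omega>) \<in> borel_measurable (lborel \<Otimes>\<^sub>M M)"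
  unfolding gap_eq[abs_def] case_prod_beta' by measurable

lemma perimeter_excess_nn_integral:
  assumes "norm p = 1"
  shows "(\<integral>\<^sup>+\<theta>. ennreal (indicator {-pi/2..pi/2} \<theta> * gap Z n (dir p \<theta>) \<omega>) \<partial>lborel)
    = ennreal (hull_perimeter Z n \<omega> - 2 * (walk Z n \<omega> \<bullet> p))"
proof (rule nn_integral_has_integral_lborel)
  show "(\<lambda>\<theta>. indicator {-pi/2..pi/2} \<theta> * gap Z n (dir p \<theta>) \<omega>) \<in> borel_measurable borel"
    unfolding gap_eq by measurable
  have "((\<lambda>\<theta>. if \<theta> \<in> {-pi/2..pi/2} then gap Z n (dir p \<theta>) \<omega> else 0) has_integral
    hull_perimeter Z n \<omega> - 2 * (walk Z n \<omega> \<bullet> p)) UNIV"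
    unfolding has_integral_restrict_UNIV by (rule hull_perimeter_excess[OF assms])
  moreover have "(\<lambda>\<theta>. indicator {-pi/2..pi/2} \<theta> * gap Z n (dir p \<theta>) \<omega>) =
      (\<lambda>\<theta>. if \<theta> \<in> {-pi/2..pi/2} then gap Z n (dir p \<theta>) \<omega> else 0)"
    by (auto simp: fun_eq_iff)
  ultimately show "((\<lambda>\<theta>. indicator {-pi/2..pi/2} \<theta> * gap Z n (dir p \<theta>) \<omega>) has_integral
    hull_perimeter Z n \<omega> - 2 * (walk Z n \<omega> \<bullet> p)) UNIV" by simp
qed (simp add: gap_nonneg)

lemma perimeter_excess_nonneg:
  "norm p = 1 \<Longrightarrow> 0 \<le> hull_perimeter Z n \<omega> - 2 * (walk Z n \<omega> \<bullet> p)"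
  by (rule has_integral_nonneg[OF hull_perimeter_excess]) (auto simp: gap_nonneg)

lemma perimeter_excess_measurable:
  assumes "norm p = 1"
  shows "(\<lambda>\<omega>. hull_perimeter Z n \<omega> - 2 * (walk Z n \<omega> \<bullet> p)) \<in> borel_measurable M"
proof -
  have "hull_perimeter Z n \<omega> - 2 * (walk Z n \<omega> \<bullet> p) =
      enn2real (\<integral>\<^sup>+\<theta>. ennreal (indicator {-pi/2..pi/2} \<theta> * gap Z n (dir p \<theta>) \<omega>) \<partial>lborel)" for \<omega>
    using perimeter_excess_nn_integral[OF assms] perimeter_excess_nonneg[OF assms] by simp
  moreover have "(\<lambda>\<omega>. enn2real (\<integral>\<^sup>+\<theta>. ennreal (indicator {-pi/2..pi/2} \<theta> * gap Z n (dir p \<theta>) \<omega>) \<partial>lborel)) \<in> borel_measurable M"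
  proof -
    interpret pair_sigma_finite lborel M ..
    have "(\<lambda>(\<omega>, \<theta>). gap Z n (dir p \<theta>) \<omega>) \<in> borel_measurable (M \<Otimes>\<^sub>M lborel)"
      unfolding gap_eq[abs_def] case_prod_beta' by measurable
    then show ?thesis by measurable
  qed
  ultimately show ?thesis by simp
qed

text \<open>The excess is the integral of the gap over an interval of length \<open>\<pi>\<close>. The Cauchy-Schwarz inequality bounds its
square by \<open>\<pi>\<close> times the integral of the squared gap, and Tonelli's theorem moves the expectation inside.\<close>
lemma perimeter_excess_second_moment:
  assumes p: "norm p = 1" and drift: "\<And>\<theta>. \<theta> \<in> {-pi/2..pi/2} \<Longrightarrow> 0 \<le> expectation (Z 0) \<bullet> dir p \<theta>"
  shows "integrable lborel (\<lambda>\<theta>. indicator {-pi/2..pi/2} \<theta> * expectation (\<lambda>\<omega>. (gap Z n (dir p \<theta>) \<omega>)\<^sup>2))" (is "integrable _ ?E")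
    and "integrable M (\<lambda>\<omega>. (hull_perimeter Z n \<omega> - 2 * (walk Z n \<omega> \<bullet> p))\<^sup>2)"
    and "expectation (\<lambda>\<omega>. (hull_perimeter Z n \<omega> - 2 * (walk Z n \<omega> \<bullet> p))\<^sup>2) \<le>
      pi * (\<integral>\<theta>. indicator {-pi/2..pi/2} \<theta> * expectation (\<lambda>\<omega>. (gap Z n (dir p \<theta>) \<omega>)\<^sup>2) \<partial>lborel)"
proof -
  interpret pair_sigma_finite lborel M ..
  let ?I = "{-pi/2..pi/2}" and ?D = "\<lambda>\<omega>. hull_perimeter Z n \<omega> - 2 * (walk Z n \<omega> \<bullet> p)"
  let ?c = "4 * (real n * expectation (\<lambda>\<omega>. (norm (Z 0 \<omega>))\<^sup>2))"
  have nd: "norm (dir p \<theta>) = 1" for \<theta> using p by (simp add: norm_dir)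
  have swapm: "(\<lambda>(\<omega>, \<theta>). gap Z n (dir p \<theta>) \<omega>) \<in> borel_measurable (M \<Otimes>\<^sub>M lborel)"
    unfolding gap_eq[abs_def] case_prod_beta' by measurable
  have Em: "?E \<in> borel_measurable lborel" by measurable
  have E0: "0 \<le> ?E \<theta>" for \<theta> by (intro mult_nonneg_nonneg integral_nonneg_AE) auto
  have Ele: "?E \<theta> \<le> ?c * indicator ?I \<theta>" for \<theta>
    using gap_second_moment(2)[OF nd drift] by (simp add: indicator_def)
  have "integrable lborel (\<lambda>\<theta>. ?c * indicator ?I \<theta>)" by simp
  then show E: "integrable lborel ?E"
    by (rule Bochner_Integration.integrable_bound[OF _ Em])
      (use E0 Ele in \<open>auto intro!: AE_I2 order_trans[OF Ele abs_ge_self] simp: abs_of_nonneg simp del: abs_mult\<close>)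
  have CS: "ennreal ((?D \<omega>)\<^sup>2) \<le> ennreal pi * (\<integral>\<^sup>+\<theta>. ennreal (indicator ?I \<theta> * (gap Z n (dir p \<theta>) \<omega>)\<^sup>2) \<partial>lborel)" if "\<omega> \<in> space M" for \<omega>
  proof -
    let ?f = "\<lambda>\<theta>. ennreal (indicator ?I \<theta> * gap Z n (dir p \<theta>) \<omega>)"
    have fm: "?f \<in> borel_measurable lborel" unfolding gap_eq by measurable
    have "ennreal ((?D \<omega>)\<^sup>2) = (ennreal (?D \<omega>))\<^sup>2"
      using perimeter_excess_nonneg[OF p] by (simp add: ennreal_power)
    also have "\<dots> = (\<integral>\<^sup>+\<theta>. ?f \<theta> * indicator ?I \<theta> \<partial>lborel)\<^sup>2"
      unfolding perimeter_excess_nn_integral[OF p, symmetric]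
      by (intro arg_cong[where f = "\<lambda>x. x\<^sup>2"] nn_integral_cong) (auto simp: indicator_def)
    also have "\<dots> \<le> (\<integral>\<^sup>+\<theta>. (?f \<theta>)\<^sup>2 \<partial>lborel) * (\<integral>\<^sup>+\<theta>. (indicator ?I \<theta>)\<^sup>2 \<partial>lborel)"
      by (rule Cauchy_Schwarz_nn_integral[OF fm]) simp
    also have "(\<integral>\<^sup>+\<theta>. (?f \<theta>)\<^sup>2 \<partial>lborel) = (\<integral>\<^sup>+\<theta>. ennreal (indicator ?I \<theta> * (gap Z n (dir p \<theta>) \<omega>)\<^sup>2) \<partial>lborel)"
      by (intro nn_integral_cong) (auto simp: indicator_def ennreal_power gap_nonneg)
    also have "(\<integral>\<^sup>+\<theta>. (indicator ?I \<theta>)\<^sup>2 \<partial>lborel) = (\<integral>\<^sup>+\<theta>. indicator ?I \<theta> \<partial>lborel)"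
      by (intro nn_integral_cong) (auto simp: indicator_def)
    also have "\<dots> = ennreal pi" by simp
    finally show ?thesis by (simp add: mult.commute)
  qed
  have "(\<integral>\<^sup>+\<omega>. ennreal ((?D \<omega>)\<^sup>2) \<partial>M) \<le> (\<integral>\<^sup>+\<omega>. ennreal pi * (\<integral>\<^sup>+\<theta>. ennreal (indicator ?I \<theta> * (gap Z n (dir p \<theta>) \<omega>)\<^sup>2) \<partial>lborel) \<partial>M)"
    by (rule nn_integral_mono) (rule CS)
  also have "\<dots> = ennreal pi * (\<integral>\<^sup>+\<omega>. (\<integral>\<^sup>+\<theta>. ennreal (indicator ?I \<theta> * (gap Z n (dir p \<theta>) \<omega>)\<^sup>2) \<partial>lborel) \<partial>M)"
    using swapm by (intro nn_integral_cmult) measurable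
  also have "(\<integral>\<^sup>+\<omega>. (\<integral>\<^sup>+\<theta>. ennreal (indicator ?I \<theta> * (gap Z n (dir p \<theta>) \<omega>)\<^sup>2) \<partial>lborel) \<partial>M) =
      (\<integral>\<^sup>+\<theta>. (\<integral>\<^sup>+\<omega>. ennreal (indicator ?I \<theta> * (gap Z n (dir p \<theta>) \<omega>)\<^sup>2) \<partial>M) \<partial>lborel)"
    by (rule Fubini') measurable
  also have "\<dots> = (\<integral>\<^sup>+\<theta>. ennreal (?E \<theta>) \<partial>lborel)"
  proof (rule nn_integral_cong)
    fix \<theta> :: real
    show "(\<integral>\<^sup>+\<omega>. ennreal (indicator ?I \<theta> * (gap Z n (dir p \<theta>) \<omega>)\<^sup>2) \<partial>M) = ennreal (?E \<theta>)"
    proof (cases "\<theta> \<in> ?I")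
      case True
      then show ?thesis
        using nn_integral_eq_integral[OF gap_second_moment(1)[OF nd drift[OF True], of n]] by simp
    qed simp
  qed
  also have "\<dots> = ennreal (\<integral>\<theta>. ?E \<theta> \<partial>lborel)"
    by (rule nn_integral_eq_integral[OF E]) (use E0 in auto)
  finally have le: "(\<integral>\<^sup>+\<omega>. ennreal ((?D \<omega>)\<^sup>2) \<partial>M) \<le> ennreal (pi * (\<integral>\<theta>. ?E \<theta> \<partial>lborel))"
    by (simp add: ennreal_mult')
  have Dm: "(\<lambda>\<omega>. (?D \<omega>)\<^sup>2) \<in> borel_measurable M"
    using perimeter_excess_measurable[OF p] by (rule borel_measurable_power)
  show I: "integrable M (\<lambda>\<omega>. (?D \<omega>)\<^sup>2)"
  proof (rule integrableI_bounded[OF Dm])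
    have "(\<integral>\<^sup>+\<omega>. ennreal (norm ((?D \<omega>)\<^sup>2)) \<partial>M) = (\<integral>\<^sup>+\<omega>. ennreal ((?D \<omega>)\<^sup>2) \<partial>M)" by simp
    also have "\<dots> < \<infinity>" using le by (rule order_le_less_trans) simp
    finally show "(\<integral>\<^sup>+\<omega>. ennreal (norm ((?D \<omega>)\<^sup>2)) \<partial>M) < \<infinity>" .
  qed
  have "0 \<le> (\<integral>\<theta>. ?E \<theta> \<partial>lborel)" by (intro integral_nonneg_AE) (use E0 in auto)
  then show "expectation (\<lambda>\<omega>. (?D \<omega>)\<^sup>2) \<le> pi * (\<integral>\<theta>. ?E \<theta> \<partial>lborel)"
    using le nn_integral_eq_integral[OF I] by simp
qed

text \<open>Dominated convergence in \<open>\<theta>\<close>: the drift in direction \<open>dir p \<theta>\<close> is \<open>r cos \<theta>\<close>, which is positive except at the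
two end points of the interval, and the linear bound on the second moment of the gap provides the dominating function.\<close>
lemma perimeter_excess_tendsto:
  assumes p: "norm p = 1" and drift: "expectation (Z 0) = r *\<^sub>R p" "0 < r"
  shows "(\<lambda>n. expectation (\<lambda>\<omega>. (hull_perimeter Z n \<omega> - 2 * (walk Z n \<omega> \<bullet> p))\<^sup>2) / real n) \<longlonglongrightarrow> 0"
proof -
  let ?I = "{-pi/2..pi/2}"
  let ?E = "\<lambda>n \<theta>. indicator ?I \<theta> * expectation (\<lambda>\<omega>. (gap Z n (dir p \<theta>) \<omega>)\<^sup>2)"
  let ?c = "4 * expectation (\<lambda>\<omega>. (norm (Z 0 \<omega>))\<^sup>2)"
  have c0: "0 \<le> ?c" by simp
  have nd: "norm (dir p \<theta>) = 1" for \<theta> using p by (simp add: norm_dir)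
  have d: "expectation (Z 0) \<bullet> dir p \<theta> = r * cos \<theta>" for \<theta>
    by (simp add: drift inner_dir_self[OF p])
  have d0: "0 \<le> expectation (Z 0) \<bullet> dir p \<theta>" if "\<theta> \<in> ?I" for \<theta>
    using that drift(2) by (auto simp: d intro!: mult_nonneg_nonneg cos_ge_zero)
  note sm = perimeter_excess_second_moment[OF p d0]
  have nonneg: "0 \<le> ?E n \<theta>" for n \<theta> by (intro mult_nonneg_nonneg integral_nonneg_AE) auto
  have "(\<lambda>n. \<integral>\<theta>. ?E n \<theta> / real n \<partial>lborel) \<longlonglongrightarrow> (\<integral>\<theta>. 0 \<partial>(lborel :: real measure))"
  proof (rule integral_dominated_convergence)
    show "integrable lborel (\<lambda>\<theta>. ?c * indicator ?I \<theta> :: real)" by simp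
    have "AE \<theta> in lborel. \<theta> \<notin> {-pi/2, pi/2}"
      by (intro AE_not_in finite_imp_null_set_lborel) simp
    then show "AE \<theta> in lborel. (\<lambda>n. ?E n \<theta> / real n) \<longlonglongrightarrow> 0"
    proof eventually_elim
      fix \<theta> :: real assume *: "\<theta> \<notin> {-pi/2, pi/2}"
      show "(\<lambda>n. ?E n \<theta> / real n) \<longlonglongrightarrow> 0"
      proof (cases "\<theta> \<in> ?I")
        case True
        then have "0 < r * cos \<theta>" using * drift(2) by (intro mult_pos_pos cos_gt_zero_pi) auto
        then show ?thesis using gap_second_moment_tendsto[OF nd, of \<theta>] True by (simp add: d)
      qed simp
    qed
    show "AE \<theta> in lborel. norm (?E n \<theta> / real n) \<le> ?c * indicator ?I \<theta>" for n
    proof (rule AE_I2)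
      fix \<theta> :: real
      show "norm (?E n \<theta> / real n) \<le> ?c * indicator ?I \<theta>"
      proof (cases "\<theta> \<in> ?I \<and> n \<noteq> 0")
        case True
        then have "?E n \<theta> \<le> real n * ?c" using gap_second_moment(2)[OF nd d0, of \<theta> n] by simp
        then have "?E n \<theta> / real n \<le> ?c" using True by (simp add: pos_divide_le_eq mult.commute)
        moreover have "0 \<le> ?E n \<theta> / real n" using nonneg by simp
        ultimately show ?thesis using True by simp
      qed (use c0 in auto)
    qed
  qed measurable
  then have "(\<lambda>n. pi * (\<integral>\<theta>. ?E n \<theta> / real n \<partial>lborel)) \<longlonglongrightarrow> pi * 0"
    by (intro tendsto_mult_left) simp
  then have lim: "(\<lambda>n. pi * (\<integral>\<theta>. ?E n \<theta> \<partial>lborel) / real n) \<longlonglongrightarrow> 0" by simp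
  show ?thesis
  proof (rule tendsto_sandwich[OF _ _ tendsto_const lim])
    show "\<forall>\<^sub>F n in sequentially. 0 \<le> expectation (\<lambda>\<omega>. (hull_perimeter Z n \<omega> - 2 * (walk Z n \<omega> \<bullet> p))\<^sup>2) / real n"
      by (intro always_eventually allI divide_nonneg_nonneg integral_nonneg_AE) auto
    show "\<forall>\<^sub>F n in sequentially. expectation (\<lambda>\<omega>. (hull_perimeter Z n \<omega> - 2 * (walk Z n \<omega> \<bullet> p))\<^sup>2) / real n
        \<le> pi * (\<integral>\<theta>. ?E n \<theta> \<partial>lborel) / real n"
      by (intro always_eventually allI divide_right_mono sm(3)) auto
  qed
qed

end

theorem theorem1p7:
  fixes M :: "'a measure" and Z :: "nat \<Rightarrow> 'a \<Rightarrow> real^2" and \<mu> :: "real^2"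
  assumes "prob_space M"
    and "iid M Z"
    and "integrable M (\<lambda>\<omega>. (norm (Z 0 \<omega>))\<^sup>2)"
    and "\<mu> = (\<integral>\<omega>. Z 0 \<omega> \<partial>M)"
    and "\<mu> \<noteq> 0"
  shows "tendsto_L2 M
    (\<lambda>n \<omega>. real n powr (-1/2) *
       \<bar>hull_perimeter Z n \<omega> - 2 * (walk Z n \<omega> \<bullet> (\<mu> /\<^sub>R norm \<mu>))\<bar>)
    (\<lambda>_. 0)"
proof -
  interpret prob_space M by fact
  interpret planar_iid M Z
    using assms(2,3) by unfold_locales (auto simp: iid_def)
  define p where "p = \<mu> /\<^sub>R norm \<mu>"
  have p: "norm p = 1" and mean: "expectation (Z 0) = norm \<mu> *\<^sub>R p" and r: "0 < norm \<mu>"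
    using assms(4,5) by (auto simp: p_def)
  let ?D = "\<lambda>n \<omega>. hull_perimeter Z n \<omega> - 2 * (walk Z n \<omega> \<bullet> p)"
  have d0: "0 \<le> expectation (Z 0) \<bullet> dir p \<theta>" if "\<theta> \<in> {-pi/2..pi/2}" for \<theta>
    using that by (auto simp: mean inner_dir_self[OF p] intro!: mult_nonneg_nonneg cos_ge_zero)
  have sq: "(real n powr (-1/2) * \<bar>x\<bar>)\<^sup>2 = x\<^sup>2 / real n" for n :: nat and x :: real
    by (cases "n = 0") (auto simp: power_mult_distrib powr_half_sqrt powr_minus_divide power_divide)
  show ?thesis
    unfolding tendsto_L2_def p_def[symmetric]
  proof (intro conjI allI)
    fix n
    show "(\<lambda>\<omega>. real n powr (-1/2) * \<bar>?D n \<omega>\<bar>) \<in> borel_measurable M"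
      using perimeter_excess_measurable[OF p] by measurable
    show "integrable M (\<lambda>\<omega>. (real n powr (-1/2) * \<bar>?D n \<omega>\<bar>)\<^sup>2)"
      unfolding sq using perimeter_excess_second_moment(2)[OF p d0] by simp
  next
    show "(\<lambda>n. \<integral>\<omega>. (real n powr (-1/2) * \<bar>?D n \<omega>\<bar> - 0)\<^sup>2 \<partial>M) \<longlonglongrightarrow> 0"
      unfolding diff_zero sq using perimeter_excess_tendsto[OF p mean r] by simp
  qed auto
qed

end
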